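(* For every countable field $K$ there are valuation domains $R_1$ and $R_2$, both of cardinality $\aleph_1$, both with residue field (isomorphic to) $K$ and with the same value group, such that their quotient fields $Q_1$ and $Q_2$ are generated as $R_1$-, resp. $R_2$-modules by $\aleph_1$ but not by countably many elements, and such that the type $Q_1/R_1$ is essentially uncountable and the type $Q_2/R_2$ is strongly countable.
   Context: A valuation domain is an integral domain whose ideals are linearly ordered by inclusion; its quotient field is denoted $Q$ (with $Q\neq R$). For a valuation domain $R$ of cardinality $\aleph_1$ and an $R$-submodule $J$ of $Q$ with $R\subseteq J$ which is not countably generated, write $J=\bigcup_{\sigma<\omega_1} r_\sigma^{-1}R$ with nonzero $r_\sigma\in R$ such that for $\tau<\sigma$, $r_\tau\mid r_\sigma$ and $r_\sigma\nmid r_\tau$. The type $J/R$ is essentially uncountable if for every $\sigma<\omega_1$ there is $\tau>\sigma$ with $r_\sigma R/r_\tau R$ uncountable; otherwise it is essentially countable. It is strongly countable if $R/r_\sigma R$ is countable for every $\sigma<\omega_1$. These notions are independent of the choice of the $r_\sigma$. *)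

theory Defs
  imports "HOL-Algebra.Algebra"
begin

text \<open>aleph_1 is the cardinal successor of the cardinal of nat; as a well-order,
  cardSuc natLeq is (a copy of) the initial ordinal omega_1, with field omega1_idx.\<close>

abbreviation aleph1 :: "nat set rel" where
  "aleph1 \<equiv> cardSuc natLeq"

abbreviation omega1_idx :: "nat set set" where
  "omega1_idx \<equiv> Field aleph1"

definition card_eq_aleph1 :: "'a set \<Rightarrow> bool" where
  "card_eq_aleph1 A \<longleftrightarrow> (card_of A, aleph1) \<in> ordIso"

definition card_le_aleph1 :: "'a set \<Rightarrow> bool" where
  "card_le_aleph1 A \<longleftrightarrow> (card_of A, aleph1) \<in> ordLeq"

abbreviation subring_ring :: "('a, 'b) ring_scheme \<Rightarrow> 'a set \<Rightarrow> ('a, 'b) ring_scheme" where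
  "subring_ring Q R \<equiv> Q\<lparr>carrier := R\<rparr>"

definition quotient_field_of :: "('a, 'b) ring_scheme \<Rightarrow> 'a set \<Rightarrow> bool" where
  "quotient_field_of Q R \<longleftrightarrow> field Q \<and> subring R Q \<and>
     (\<forall>x\<in>carrier Q. \<exists>a\<in>R. \<exists>b\<in>R. b \<noteq> \<zero>\<^bsub>Q\<^esub> \<and> x = a \<otimes>\<^bsub>Q\<^esub> inv\<^bsub>Q\<^esub> b)"

definition valuation_domain :: "('a, 'b) ring_scheme \<Rightarrow> bool" where
  "valuation_domain R \<longleftrightarrow> domain R \<and>
     (\<forall>I J. ideal I R \<longrightarrow> ideal J R \<longrightarrow> I \<subseteq> J \<or> J \<subseteq> I)"

text \<open>R is a valuation domain with quotient field Q, and Q is different from R (standing assumption).\<close>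
definition valuation_domain_in :: "('a, 'b) ring_scheme \<Rightarrow> 'a set \<Rightarrow> bool" where
  "valuation_domain_in Q R \<longleftrightarrow> quotient_field_of Q R \<and> valuation_domain (subring_ring Q R)
     \<and> R \<noteq> carrier Q"

definition max_ideal :: "('a, 'b) ring_scheme \<Rightarrow> 'a set \<Rightarrow> 'a set" where
  "max_ideal Q R = R - Units (subring_ring Q R)"

definition residue_field :: "('a, 'b) ring_scheme \<Rightarrow> 'a set \<Rightarrow> 'a set ring" where
  "residue_field Q R = (subring_ring Q R) Quot (max_ideal Q R)"

definition value_group :: "('a, 'b) ring_scheme \<Rightarrow> 'a set \<Rightarrow> 'a set monoid" where
  "value_group Q R = (mult_of Q) Mod (Units (subring_ring Q R))"

definition value_le :: "('a, 'b) ring_scheme \<Rightarrow> 'a set \<Rightarrow> 'a set \<Rightarrow> 'a set \<Rightarrow> bool" where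
  "value_le Q R A B \<longleftrightarrow> (\<exists>a\<in>A. \<exists>b\<in>B. b \<otimes>\<^bsub>Q\<^esub> inv\<^bsub>Q\<^esub> a \<in> R)"

definition same_value_group ::
  "('a, 'b) ring_scheme \<Rightarrow> 'a set \<Rightarrow> ('c, 'd) ring_scheme \<Rightarrow> 'c set \<Rightarrow> bool" where
  "same_value_group Q1 R1 Q2 R2 \<longleftrightarrow>
     (\<exists>\<phi>. \<phi> \<in> iso (value_group Q1 R1) (value_group Q2 R2) \<and>
        (\<forall>A\<in>carrier (value_group Q1 R1). \<forall>B\<in>carrier (value_group Q1 R1).
            value_le Q1 R1 A B \<longleftrightarrow> value_le Q2 R2 (\<phi> A) (\<phi> B)))"

definition rspan :: "('a, 'b) ring_scheme \<Rightarrow> 'a set \<Rightarrow> 'a set \<Rightarrow> 'a set" where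
  "rspan Q R S = {finsum Q (\<lambda>s. c s \<otimes>\<^bsub>Q\<^esub> s) F | F c. finite F \<and> F \<subseteq> S \<and> c \<in> F \<rightarrow> R}"

definition principal :: "('a, 'b) ring_scheme \<Rightarrow> 'a set \<Rightarrow> 'a \<Rightarrow> 'a set" where
  "principal Q R r = {r \<otimes>\<^bsub>Q\<^esub> x | x. x \<in> R}"

definition rdvd :: "('a, 'b) ring_scheme \<Rightarrow> 'a set \<Rightarrow> 'a \<Rightarrow> 'a \<Rightarrow> bool" where
  "rdvd Q R a b \<longleftrightarrow> (\<exists>x\<in>R. b = a \<otimes>\<^bsub>Q\<^esub> x)"

definition cosets_in :: "('a, 'b) ring_scheme \<Rightarrow> 'a set \<Rightarrow> 'a set \<Rightarrow> 'a set set" where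
  "cosets_in Q M N = {(\<lambda>y. a \<oplus>\<^bsub>Q\<^esub> y) ` N | a. a \<in> M}"

definition omega1_rep :: "('a, 'b) ring_scheme \<Rightarrow> 'a set \<Rightarrow> 'a set \<Rightarrow> (nat set \<Rightarrow> 'a) \<Rightarrow> bool" where
  "omega1_rep Q R J r \<longleftrightarrow>
     (\<forall>\<sigma>\<in>omega1_idx. r \<sigma> \<in> R \<and> r \<sigma> \<noteq> \<zero>\<^bsub>Q\<^esub>) \<and>
     (\<forall>\<tau>\<in>omega1_idx. \<forall>\<sigma>\<in>omega1_idx. (\<tau>, \<sigma>) \<in> aleph1 \<and> \<tau> \<noteq> \<sigma> \<longrightarrow>
         rdvd Q R (r \<tau>) (r \<sigma>) \<and> \<not> rdvd Q R (r \<sigma>) (r \<tau>)) \<and>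
     J = (\<Union>\<sigma>\<in>omega1_idx. principal Q R (inv\<^bsub>Q\<^esub> (r \<sigma>)))"

definition essentially_uncountable_type :: "('a, 'b) ring_scheme \<Rightarrow> 'a set \<Rightarrow> 'a set \<Rightarrow> bool" where
  "essentially_uncountable_type Q R J \<longleftrightarrow> (\<exists>r. omega1_rep Q R J r) \<and>
     (\<forall>r. omega1_rep Q R J r \<longrightarrow>
        (\<forall>\<sigma>\<in>omega1_idx. \<exists>\<tau>\<in>omega1_idx. (\<sigma>, \<tau>) \<in> aleph1 \<and> \<sigma> \<noteq> \<tau> \<and>
           \<not> countable (cosets_in Q (principal Q R (r \<sigma>)) (principal Q R (r \<tau>)))))"

definition strongly_countable_type :: "('a, 'b) ring_scheme \<Rightarrow> 'a set \<Rightarrow> 'a set \<Rightarrow> bool" where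
  "strongly_countable_type Q R J \<longleftrightarrow> (\<exists>r. omega1_rep Q R J r) \<and>
     (\<forall>r. omega1_rep Q R J r \<longrightarrow>
        (\<forall>\<sigma>\<in>omega1_idx. countable (cosets_in Q R (principal Q R (r \<sigma>)))))"

end

theory Submission
  imports Defs "HOL-Library.Countable_Set_Type" "HOL-Library.Poly_Mapping"
begin

text \<open>
  Hahn series over \<open>K\<close> with exponents in an ordered abelian group form a field, valued by the least
  exponent; the valuation ring of each subfield that contains the monomials has residue field \<open>K\<close>
  and the given value group. As value group take the finitely supported functions from \<open>\<omega>\<^sub>1\<close> to the
  integers, ordered by the coefficient of the largest index at which two functions differ. Its
  cofinality is \<open>\<omega>\<^sub>1\<close>, while each element lies in a countable convex subgroup.

  \<open>Q\<^sub>1\<close> is generated by the monomials and \<open>\<aleph>\<^sub>1\<close> series with coefficients 0 and 1 whose exponents are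
  terms of a fixed bounded increasing sequence. Modulo an element whose value exceeds these exponents
  the series remain distinct, so \<open>Q\<^sub>1/R\<^sub>1\<close> is essentially uncountable. \<open>Q\<^sub>2\<close> consists of the
  fractions of series with finite support. Truncation to a convex subgroup is multiplicative on
  series with nonnegative exponents, so the truncation of an element of \<open>R\<^sub>2\<close> to a countable convex
  subgroup is a fraction of finite series with exponents in that subgroup. This leaves only countably
  many residues modulo an element with value in the subgroup.
\<close>

section \<open>Cardinality bounds\<close>

lemma card_of_image_ordLeq: "|A| \<le>o r \<Longrightarrow> |f ` A| \<le>o r"
  by (rule ordLeq_transitive[OF card_of_image])

lemma card_of_subset_ordLeq: "A \<subseteq> B \<Longrightarrow> |B| \<le>o r \<Longrightarrow> |A| \<le>o r"
  by (rule ordLeq_transitive[OF card_of_mono1])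

lemma card_of_subset_image_ordLeq: "A \<subseteq> f ` B \<Longrightarrow> |B| \<le>o r \<Longrightarrow> |A| \<le>o r"
  by (rule card_of_subset_ordLeq[OF _ card_of_image_ordLeq])

lemma card_of_Times_ordLeq:
  "Cinfinite r \<Longrightarrow> |A| \<le>o r \<Longrightarrow> |B| \<le>o r \<Longrightarrow> |A \<times> B| \<le>o r"
  by (rule card_of_Times_ordLeq_infinite_Field) (auto simp: cinfinite_def)

lemma countable_ordLeq_Cinfinite: "countable A \<Longrightarrow> Cinfinite r \<Longrightarrow> |A| \<le>o r"
  using natLeq_ordLeq_cinfinite ordLeq_transitive by (auto simp: countable_card_le_natLeq)

lemma card_of_UN_nat_ordLeq:
  "Cinfinite r \<Longrightarrow> (\<And>n::nat. |A n| \<le>o r) \<Longrightarrow> |\<Union>n. A n| \<le>o r"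
  by (intro UNION_Cinfinite_bound) (auto intro: countable_ordLeq_Cinfinite)

lemma card_of_lists_ordLeq:
  assumes r: "Cinfinite r" and A: "|A| \<le>o r"
  shows "|lists A| \<le>o r"
proof -
  have "|{xs \<in> lists A. length xs = n}| \<le>o r" for n
  proof (induction n)
    case 0
    show ?case by (rule countable_ordLeq_Cinfinite[OF _ r]) (auto intro: countable_subset[of _ "{[]}"])
  next
    case (Suc n)
    have "{xs \<in> lists A. length xs = Suc n} \<subseteq> case_prod (#) ` (A \<times> {xs \<in> lists A. length xs = n})"
      by (auto simp: length_Suc_conv)
    then show ?case by (rule card_of_subset_image_ordLeq) (rule card_of_Times_ordLeq[OF r A Suc.IH])
  qed
  then have "|\<Union>n. {xs \<in> lists A. length xs = n}| \<le>o r" by (rule card_of_UN_nat_ordLeq[OF r])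
  then show ?thesis by (rule card_of_subset_ordLeq[rotated]) auto
qed

lemma card_of_finite_support_ordLeq:
  assumes r: "Cinfinite r" and A: "|A| \<le>o r" and B: "|B| \<le>o r"
  shows "|{f. finite {x. f x \<noteq> z} \<and> (\<forall>x. f x \<noteq> z \<longrightarrow> x \<in> A \<and> f x \<in> B)}| \<le>o r" (is "|?F| \<le>o r")
proof -
  let ?read = "\<lambda>ps x. case map_of ps x of None \<Rightarrow> z | Some y \<Rightarrow> y"
  have "?F \<subseteq> ?read ` lists (A \<times> B)"
  proof
    fix f assume f: "f \<in> ?F"
    then obtain xs where xs: "set xs = {x. f x \<noteq> z}" using finite_list by blast
    have "f = ?read (map (\<lambda>x. (x, f x)) xs)"
      using xs by (auto simp: map_of_map_restrict restrict_map_def)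
    moreover have "map (\<lambda>x. (x, f x)) xs \<in> lists (A \<times> B)" using f xs by auto
    ultimately show "f \<in> ?read ` lists (A \<times> B)" by blast
  qed
  then show ?thesis
    by (rule card_of_subset_image_ordLeq) (intro card_of_lists_ordLeq card_of_Times_ordLeq r A B)
qed

lemma card_of_poly_mapping_ordLeq:
  assumes r: "Cinfinite r" and A: "|A| \<le>o r" and B: "|UNIV :: 'b::zero set| \<le>o r"
  shows "|{p :: 'a \<Rightarrow>\<^sub>0 'b. Poly_Mapping.keys p \<subseteq> A}| \<le>o r"
proof -
  let ?F = "{f :: 'a \<Rightarrow> 'b. finite {x. f x \<noteq> 0} \<and> (\<forall>x. f x \<noteq> 0 \<longrightarrow> x \<in> A \<and> f x \<in> UNIV)}"
  have "{p :: 'a \<Rightarrow>\<^sub>0 'b. Poly_Mapping.keys p \<subseteq> A} \<subseteq> Abs_poly_mapping ` ?F"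
  proof
    fix p :: "'a \<Rightarrow>\<^sub>0 'b" assume "p \<in> {p. Poly_Mapping.keys p \<subseteq> A}"
    then have "Poly_Mapping.lookup p \<in> ?F" by (auto simp: subset_iff in_keys_iff)
    then show "p \<in> Abs_poly_mapping ` ?F" by (rule image_eqI[rotated]) simp
  qed
  then show ?thesis
    by (rule card_of_subset_image_ordLeq) (rule card_of_finite_support_ordLeq[OF r A B])
qed

definition generate_field_step :: "('a, 'b) ring_scheme \<Rightarrow> 'a set \<Rightarrow> 'a set \<Rightarrow> 'a set" where
  "generate_field_step R H Y = Y \<union> insert \<one>\<^bsub>R\<^esub> H \<union> a_inv R ` Y \<union> m_inv R ` Y \<union>
    case_prod (add R) ` (Y \<times> Y) \<union> case_prod (monoid.mult R) ` (Y \<times> Y)"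

lemma generate_field_subset_UN_steps:
  "generate_field R H \<subseteq> (\<Union>n. (generate_field_step R H ^^ n) {})"
proof
  define C where "C n = (generate_field_step R H ^^ n) {}" for n
  have C_Suc: "C (Suc n) = generate_field_step R H (C n)" for n by (simp add: C_def)
  have "mono C" unfolding mono_iff_le_Suc by (auto simp: C_Suc generate_field_step_def)
  then have common: "\<exists>n. x \<in> C n \<and> y \<in> C n" if "x \<in> C l" "y \<in> C m" for x y l m
    using that by (meson monoD max.cobounded1 max.cobounded2 subsetD)
  have stepI: "x \<in> (\<Union>n. C n)" if "x \<in> generate_field_step R H (C n)" for x n
    using that unfolding C_Suc[symmetric] by blast
  fix h assume "h \<in> generate_field R H"
  then have "h \<in> (\<Union>n. C n)"
  proof induction
    case (a_inv h)
    then obtain n where "h \<in> C n" by blast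
    then show ?case by (intro stepI[of _ n]) (simp add: generate_field_step_def)
  next
    case (m_inv h)
    then obtain n where "h \<in> C n" by blast
    then show ?case by (intro stepI[of _ n]) (simp add: generate_field_step_def)
  next
    case (eng_add x y)
    then obtain n where "x \<in> C n" "y \<in> C n" using common by blast
    then show ?case by (intro stepI[of _ n]) (force simp: generate_field_step_def)
  next
    case (eng_mult x y)
    then obtain n where "x \<in> C n" "y \<in> C n" using common by blast
    then show ?case by (intro stepI[of _ n]) (force simp: generate_field_step_def)
  qed (rule stepI[of _ 0], simp add: generate_field_step_def)+
  then show "h \<in> (\<Union>n. (generate_field_step R H ^^ n) {})" by (simp add: C_def)
qed

lemma card_of_generate_field_ordLeq:
  assumes r: "Cinfinite r" and H: "|H| \<le>o r"
  shows "|generate_field R H| \<le>o r"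
proof -
  have "|insert \<one>\<^bsub>R\<^esub> H| \<le>o r"
    using Un_Cinfinite_bound[OF countable_ordLeq_Cinfinite[of "{\<one>\<^bsub>R\<^esub>}"] H r] r by simp
  then have step: "|generate_field_step R H Y| \<le>o r" if "|Y| \<le>o r" for Y
    unfolding generate_field_step_def using that
    by (intro Un_Cinfinite_bound card_of_image_ordLeq card_of_Times_ordLeq r)
  have "|(generate_field_step R H ^^ n) {}| \<le>o r" for n
    by (induction n) (simp_all add: countable_ordLeq_Cinfinite r step)
  then show ?thesis
    by (intro card_of_subset_ordLeq[OF generate_field_subset_UN_steps] card_of_UN_nat_ordLeq r)
qed

section \<open>Fractions in a field\<close>

definition fractions :: "('a, 'b) ring_scheme \<Rightarrow> 'a set \<Rightarrow> 'a set" where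
  "fractions R B = {a \<otimes>\<^bsub>R\<^esub> inv\<^bsub>R\<^esub> b | a b. a \<in> B \<and> b \<in> B \<and> b \<noteq> \<zero>\<^bsub>R\<^esub>}"

context field
begin

lemma inv_of_nonzero:
  assumes "x \<in> carrier R" "x \<noteq> \<zero>"
  shows "inv x \<in> carrier R" "inv x \<noteq> \<zero>" "x \<otimes> inv x = \<one>" "inv x \<otimes> x = \<one>"
proof -
  have "x \<in> Units R" using assms by (simp add: field_Units)
  then show inv: "inv x \<in> carrier R" "x \<otimes> inv x = \<one>" "inv x \<otimes> x = \<one>" by auto
  then show "inv x \<noteq> \<zero>" using assms by auto
qed

lemma eq_mult_inv_iff:
  assumes "x \<in> carrier R" "a \<in> carrier R" "b \<in> carrier R" "b \<noteq> \<zero>"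
  shows "x = a \<otimes> inv b \<longleftrightarrow> x \<otimes> b = a"
  using assms inv_of_nonzero[of b] by (auto simp: m_assoc)

lemma fractionsI:
  assumes "subring B R" "x \<in> carrier R" "b \<in> B" "b \<noteq> \<zero>" "x \<otimes> b \<in> B"
  shows "x \<in> fractions R B"
proof -
  have "b \<in> carrier R" using assms(1,3) subringE(1) by blast
  then have "x = (x \<otimes> b) \<otimes> inv b" using eq_mult_inv_iff[of x "x \<otimes> b" b] assms by simp
  then show ?thesis using assms unfolding fractions_def by blast
qed

lemma fractionsE:
  assumes "subring B R" "x \<in> fractions R B"
  obtains b where "x \<in> carrier R" "b \<in> B" "b \<noteq> \<zero>" "x \<otimes> b \<in> B"
proof -
  obtain a b where x: "x = a \<otimes> inv b" and ab: "a \<in> B" "b \<in> B" "b \<noteq> \<zero>"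
    using assms(2) unfolding fractions_def by blast
  have carrier: "a \<in> carrier R" "b \<in> carrier R" using ab subringE(1)[OF assms(1)] by auto
  then have "x \<in> carrier R" "x \<otimes> b = a"
    using x eq_mult_inv_iff[of x a b] inv_of_nonzero[of b] ab(3) by auto
  then show thesis using that ab by blast
qed

lemma subset_fractions:
  assumes "subring B R"
  shows "B \<subseteq> fractions R B"
proof
  fix x assume x: "x \<in> B"
  then show "x \<in> fractions R B"
    using subringE(1,3)[OF assms] by (intro fractionsI[OF assms, of x \<one>]) auto
qed

lemma subfield_fractions:
  assumes B: "subring B R"
  shows "subfield (fractions R B) R"
proof -
  note [simp] = subringE(1)[OF B, THEN subsetD]
  have closed: "\<ominus> x \<in> fractions R B" "x \<oplus> y \<in> fractions R B" "x \<otimes> y \<in> fractions R B"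
    if x: "x \<in> fractions R B" and y: "y \<in> fractions R B" for x y
  proof -
    obtain b where b: "x \<in> carrier R" "b \<in> B" "b \<noteq> \<zero>" "x \<otimes> b \<in> B" using B x by (rule fractionsE)
    obtain d where d: "y \<in> carrier R" "d \<in> B" "d \<noteq> \<zero>" "y \<otimes> d \<in> B" using B y by (rule fractionsE)
    have carrier: "x \<in> carrier R" "y \<in> carrier R" "b \<in> carrier R" "d \<in> carrier R" using b d by auto
    have bd: "b \<otimes> d \<in> B" "b \<otimes> d \<noteq> \<zero>" using b d by (auto simp: integral_iff subringE(6)[OF B])
    have "(\<ominus> x) \<otimes> b = \<ominus> (x \<otimes> b)" "(x \<oplus> y) \<otimes> (b \<otimes> d) = (x \<otimes> b) \<otimes> d \<oplus> (y \<otimes> d) \<otimes> b"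
      "(x \<otimes> y) \<otimes> (b \<otimes> d) = (x \<otimes> b) \<otimes> (y \<otimes> d)"
      using carrier by algebra+
    then have "(\<ominus> x) \<otimes> b \<in> B" "(x \<oplus> y) \<otimes> (b \<otimes> d) \<in> B" "(x \<otimes> y) \<otimes> (b \<otimes> d) \<in> B"
      using b d by (simp_all add: subringE(5-7)[OF B])
    then show "\<ominus> x \<in> fractions R B" "x \<oplus> y \<in> fractions R B" "x \<otimes> y \<in> fractions R B"
      using b bd carrier by (auto intro: fractionsI[OF B])
  qed
  show ?thesis
  proof (rule subfieldI')
    have "fractions R B \<subseteq> carrier R" using fractionsE[OF B] by (metis subsetI)
    then show "subring (fractions R B) R"
      using closed subset_fractions[OF B] subringE(3)[OF B] by (intro subringI) auto
    fix x assume "x \<in> fractions R B - {\<zero>}"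
    then obtain b where b: "x \<in> carrier R" "x \<noteq> \<zero>" "b \<in> B" "b \<noteq> \<zero>" "x \<otimes> b \<in> B"
      by (metis DiffE singletonI fractionsE[OF B])
    have "inv x \<otimes> (x \<otimes> b) = b" using b inv_of_nonzero[of x] by (simp add: m_assoc[symmetric])
    then show "inv x \<in> fractions R B"
      using b inv_of_nonzero[of x] by (intro fractionsI[OF B, of _ "x \<otimes> b"]) (auto simp: integral_iff)
  qed
qed

lemma card_of_fractions_ordLeq:
  assumes "Cinfinite r" "|B| \<le>o r"
  shows "|fractions R B| \<le>o r"
proof -
  have "fractions R B \<subseteq> (\<lambda>(a, b). a \<otimes> inv b) ` (B \<times> B)" by (auto simp: fractions_def)
  then show ?thesis
    by (rule card_of_subset_image_ordLeq) (rule card_of_Times_ordLeq[OF assms(1) assms(2,2)])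
qed

lemma subfield_copy:
  fixes f :: "'a \<Rightarrow> 'c"
  assumes P: "subfield P R" and f: "inj_on f P"
  obtains Q :: "'c ring" and e where "field Q" "e \<in> ring_hom Q R" "bij_betw e (carrier Q) P"
proof -
  let ?P = "R\<lparr>carrier := P\<rparr>"
  have inj: "inj_on f (carrier ?P)" using f by simp
  have field: "field ?P" by (rule subfield_iff(2)[OF P])
  then have ring: "ring ?P" by (rule field.is_ring)
  have "inv_into P f \<in> ring_iso (image_ring f ?P) ?P"
    using ring_iso_set_sym[OF ring inj_imp_image_ring_iso[OF inj]] by simp
  then have hom: "inv_into P f \<in> ring_hom (image_ring f ?P) ?P"
    and bij: "bij_betw (inv_into P f) (carrier (image_ring f ?P)) P"
    by (auto simp: ring_iso_def)
  have "inv_into P f \<in> ring_hom (image_ring f ?P) R"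
    using hom subfieldE(3)[OF P] unfolding ring_hom_def by auto
  then show thesis
    using that field.inj_imp_image_ring_is_field[OF field inj] bij by blast
qed

end

section \<open>Valued fields\<close>

locale valued_field = field R for R (structure) +
  fixes v :: "'a \<Rightarrow> 'g::linordered_ab_group_add"
  assumes v_mult: "\<lbrakk>x \<in> carrier R; x \<noteq> \<zero>; y \<in> carrier R; y \<noteq> \<zero>\<rbrakk> \<Longrightarrow> v (x \<otimes> y) = v x + v y"
    and v_add: "\<lbrakk>x \<in> carrier R; x \<noteq> \<zero>; y \<in> carrier R; y \<noteq> \<zero>; x \<oplus> y \<noteq> \<zero>\<rbrakk> \<Longrightarrow>
      min (v x) (v y) \<le> v (x \<oplus> y)"
begin

definition vball :: "'g \<Rightarrow> 'a set" where
  "vball g = {x \<in> carrier R. x = \<zero> \<or> g \<le> v x}"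

abbreviation vring :: "'a set" where "vring \<equiv> vball 0"

lemma v_one: "v \<one> = 0"
  using v_mult[of \<one> \<one>] by simp

lemma v_uminus:
  assumes "x \<in> carrier R" "x \<noteq> \<zero>"
  shows "v (\<ominus> x) = v x"
proof -
  have nonzero: "\<ominus> \<one> \<noteq> \<zero>" by (metis add.inv_eq_1_iff one_closed one_not_zero)
  have "v (\<ominus> \<one>) + v (\<ominus> \<one>) = v (\<ominus> \<one> \<otimes> \<ominus> \<one>)" using nonzero by (simp add: v_mult)
  then have "v (\<ominus> \<one>) = 0" by (simp add: l_minus v_one)
  moreover have "v (\<ominus> \<one> \<otimes> x) = v (\<ominus> \<one>) + v x" using nonzero assms by (simp add: v_mult)
  ultimately show ?thesis using assms by (simp add: l_minus)
qed

lemma v_inv: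
  assumes "x \<in> carrier R" "x \<noteq> \<zero>"
  shows "v (inv x) = - v x"
proof -
  have "v x + v (inv x) = 0" using v_mult[of x "inv x"] assms inv_of_nonzero[of x] by (simp add: v_one)
  then show ?thesis by (simp add: add_eq_0_iff)
qed

lemma vball_carrier: "x \<in> vball g \<Longrightarrow> x \<in> carrier R"
  by (simp add: vball_def)

lemma zero_in_vball: "\<zero> \<in> vball g"
  by (simp add: vball_def)

lemma in_vball_iff: "x \<in> carrier R \<Longrightarrow> x \<noteq> \<zero> \<Longrightarrow> x \<in> vball g \<longleftrightarrow> g \<le> v x"
  by (simp add: vball_def)

lemma vball_uminus: "x \<in> vball g \<Longrightarrow> \<ominus> x \<in> vball g"
  by (cases "x = \<zero>") (auto simp: vball_def v_uminus)

lemma vball_add: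
  assumes "x \<in> vball g" "y \<in> vball g"
  shows "x \<oplus> y \<in> vball g"
proof (cases "x = \<zero> \<or> y = \<zero> \<or> x \<oplus> y = \<zero>")
  case True
  then show ?thesis using assms by (auto simp: vball_def)
next
  case False
  then have "min (v x) (v y) \<le> v (x \<oplus> y)" using assms by (intro v_add) (auto simp: vball_def)
  then show ?thesis using False assms by (auto simp: vball_def min_le_iff_disj intro: order_trans)
qed

lemma vball_mult: "x \<in> vball g \<Longrightarrow> y \<in> vball h \<Longrightarrow> x \<otimes> y \<in> vball (g + h)"
  by (cases "x = \<zero> \<or> y = \<zero>") (auto simp: vball_def v_mult add_mono)

lemma vring_subring: "subring vring R"
proof (rule subringI)
  show "\<one> \<in> vring" by (simp add: vball_def v_one)
qed (use vball_mult[of _ 0 _ 0] in \<open>auto simp: vball_carrier vball_uminus vball_add\<close>)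

lemma vball_divide:
  assumes "x \<in> carrier R" "x \<noteq> \<zero>" "y \<in> vball (v x)"
  shows "inv x \<otimes> y \<in> vring" "x \<otimes> (inv x \<otimes> y) = y"
proof -
  have "inv x \<in> vball (- v x)" using assms inv_of_nonzero[of x] by (simp add: in_vball_iff v_inv)
  then show "inv x \<otimes> y \<in> vring" using vball_mult[OF _ assms(3)] by fastforce
  show "x \<otimes> (inv x \<otimes> y) = y"
    using assms inv_of_nonzero[of x] vball_carrier[OF assms(3)] by (simp add: m_assoc[symmetric])
qed

lemma principal_vring:
  assumes r: "r \<in> carrier R" "r \<noteq> \<zero>"
  shows "principal R vring r = vball (v r)"
proof (intro equalityI subsetI)
  fix y assume "y \<in> principal R vring r"
  then obtain x where x: "y = r \<otimes> x" "x \<in> vring" by (auto simp: principal_def)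
  have "r \<in> vball (v r)" using r by (simp add: vball_def)
  then show "y \<in> vball (v r)" using vball_mult[OF _ x(2), of r "v r"] x(1) by simp
next
  fix y assume y: "y \<in> vball (v r)"
  show "y \<in> principal R vring r"
    unfolding principal_def using vball_divide[OF r y] by (metis (mono_tags, lifting) mem_Collect_eq)
qed

lemma rdvd_vring:
  assumes "a \<in> carrier R" "a \<noteq> \<zero>"
  shows "rdvd R vring a b \<longleftrightarrow> b \<in> vball (v a)"
  unfolding principal_vring[OF assms, symmetric] by (auto simp: rdvd_def principal_def)

lemma Units_vring: "Units (R\<lparr>carrier := vring\<rparr>) = {x \<in> carrier R. x \<noteq> \<zero> \<and> v x = 0}"
proof (intro equalityI subsetI)
  fix x assume "x \<in> Units (R\<lparr>carrier := vring\<rparr>)"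
  then obtain y where xy: "x \<in> vring" "y \<in> vring" "x \<otimes> y = \<one>" by (auto simp: Units_def)
  have closed: "x \<in> carrier R" "y \<in> carrier R" using xy vball_carrier by auto
  have nonzero: "x \<noteq> \<zero>" "y \<noteq> \<zero>" using xy closed by auto
  have "v x + v y = 0" using v_mult[of x y] xy(3) closed nonzero by (simp add: v_one)
  then show "x \<in> {x \<in> carrier R. x \<noteq> \<zero> \<and> v x = 0}"
    using xy closed nonzero by (simp add: in_vball_iff add_nonneg_eq_0_iff)
next
  fix x assume "x \<in> {x \<in> carrier R. x \<noteq> \<zero> \<and> v x = 0}"
  then have x: "x \<in> carrier R" "x \<noteq> \<zero>" "v x = 0" by auto
  then have "x \<in> vring" "inv x \<in> vring" using inv_of_nonzero[of x] by (auto simp: in_vball_iff v_inv)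
  then show "x \<in> Units (R\<lparr>carrier := vring\<rparr>)" using inv_of_nonzero[OF x(1,2)] by (auto simp: Units_def)
qed

lemma max_ideal_vring: "max_ideal R vring = {x \<in> carrier R. x = \<zero> \<or> 0 < v x}"
  unfolding max_ideal_def Units_vring by (auto simp: vball_def)

lemma ideal_vring_closed:
  assumes I: "ideal I (R\<lparr>carrier := vring\<rparr>)" and x: "x \<in> I" "x \<noteq> \<zero>" and y: "y \<in> vball (v x)"
  shows "y \<in> I"
proof -
  have "I \<subseteq> vring" using additive_subgroup.a_subset[OF ideal.axioms(1)[OF I]] by simp
  then have "x \<in> carrier R" using x(1) vball_carrier by blast
  then have "inv x \<otimes> y \<in> vring" "x \<otimes> (inv x \<otimes> y) = y" using vball_divide x(2) y by auto
  then show ?thesis using ideal.I_r_closed[OF I x(1), of "inv x \<otimes> y"] by simp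
qed

lemma valuation_domain_vring: "valuation_domain (R\<lparr>carrier := vring\<rparr>)"
  unfolding valuation_domain_def
proof (intro conjI allI impI)
  have "subcring vring R" using vring_subring by (rule subcringI')
  moreover have "x = \<zero> \<or> y = \<zero>" if "x \<in> vring" "y \<in> vring" "x \<otimes> y = \<zero>" for x y
    using that integral vball_carrier by blast
  ultimately have "subdomain vring R"
    by (intro subdomain.intro subdomain_axioms.intro) auto
  then show "domain (R\<lparr>carrier := vring\<rparr>)"
    using subdomain_iff[OF subringE(1)[OF vring_subring]] by simp
  fix I J assume I: "ideal I (R\<lparr>carrier := vring\<rparr>)" and J: "ideal J (R\<lparr>carrier := vring\<rparr>)"
  show "I \<subseteq> J \<or> J \<subseteq> I"
  proof (rule ccontr)
    assume "\<not> (I \<subseteq> J \<or> J \<subseteq> I)"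
    then obtain x y where xy: "x \<in> I" "x \<notin> J" "y \<in> J" "y \<notin> I" by blast
    have "\<zero> \<in> I" "\<zero> \<in> J"
      using additive_subgroup.zero_closed[OF ideal.axioms(1)] I J by fastforce+
    then have nonzero: "x \<noteq> \<zero>" "y \<noteq> \<zero>" using xy by auto
    have "I \<subseteq> vring" "J \<subseteq> vring"
      using additive_subgroup.a_subset[OF ideal.axioms(1)] I J by fastforce+
    then have "x \<in> carrier R" "y \<in> carrier R" using xy vball_carrier by auto
    then have "y \<in> vball (v x) \<or> x \<in> vball (v y)" using nonzero by (auto simp: in_vball_iff)
    then show False using ideal_vring_closed[OF I] ideal_vring_closed[OF J] xy nonzero by blast
  qed
qed

lemma valuation_domain_in_vringI:
  assumes "x \<in> carrier R" "x \<notin> vring"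
  shows "valuation_domain_in R vring"
  unfolding valuation_domain_in_def quotient_field_of_def
proof (intro conjI ballI)
  show "field R" by (rule field_axioms)
  show "vring \<noteq> carrier R" using assms by blast
  fix y assume y: "y \<in> carrier R"
  have one: "\<one> \<in> vring" by (rule subringE(3)[OF vring_subring])
  show "\<exists>a\<in>vring. \<exists>b\<in>vring. b \<noteq> \<zero> \<and> y = a \<otimes> inv b"
  proof (cases "y \<in> vring")
    case True
    then show ?thesis using y one by (intro bexI[of _ y] bexI[of _ \<one>]) auto
  next
    case False
    then have y': "y \<noteq> \<zero>" "v y < 0" using y by (auto simp: vball_def)
    then have "inv y \<in> vring" using inv_of_nonzero[of y] y by (auto simp: in_vball_iff v_inv)
    moreover have "y = \<one> \<otimes> inv (inv y)" using y y'(1) by (simp add: field_Units)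
    ultimately show ?thesis using one inv_of_nonzero[OF y y'(1)] by blast
  qed
qed (rule vring_subring valuation_domain_vring)+

lemma vball_coset_subset:
  assumes "a \<in> carrier R" "b \<in> carrier R" "a \<ominus> b \<in> vball g"
  shows "(\<lambda>y. a \<oplus> y) ` vball g \<subseteq> (\<lambda>y. b \<oplus> y) ` vball g"
proof
  fix z assume "z \<in> (\<lambda>y. a \<oplus> y) ` vball g"
  then obtain y where y: "z = a \<oplus> y" "y \<in> vball g" by blast
  then have "z = b \<oplus> ((a \<ominus> b) \<oplus> y)" using assms(1,2) vball_carrier[OF y(2)] by algebra
  then show "z \<in> (\<lambda>y. b \<oplus> y) ` vball g" using vball_add[OF assms(3) y(2)] by blast
qed

lemma vball_coset_eq_iff:
  assumes a: "a \<in> carrier R" and b: "b \<in> carrier R"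
  shows "(\<lambda>y. a \<oplus> y) ` vball g = (\<lambda>y. b \<oplus> y) ` vball g \<longleftrightarrow> a \<ominus> b \<in> vball g"
proof
  assume "(\<lambda>y. a \<oplus> y) ` vball g = (\<lambda>y. b \<oplus> y) ` vball g"
  then have "a \<oplus> \<zero> \<in> (\<lambda>y. b \<oplus> y) ` vball g" using zero_in_vball by blast
  then obtain y where y: "a \<oplus> \<zero> = b \<oplus> y" "y \<in> vball g" by blast
  have "a \<ominus> b = (a \<oplus> \<zero>) \<ominus> b" using a b by simp
  also have "\<dots> = y" unfolding y(1) using b vball_carrier[OF y(2)] by algebra
  finally show "a \<ominus> b \<in> vball g" using y(2) by simp
next
  assume ab: "a \<ominus> b \<in> vball g"
  have "b \<ominus> a = \<ominus> (a \<ominus> b)" using a b by algebra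
  then have "b \<ominus> a \<in> vball g" using vball_uminus[OF ab] by simp
  then show "(\<lambda>y. a \<oplus> y) ` vball g = (\<lambda>y. b \<oplus> y) ` vball g"
    using vball_coset_subset a b ab by blast
qed

lemma uncountable_cosets_in_if_separated:
  assumes S: "uncountable S" "S \<subseteq> vring"
    and separated: "\<And>s t. s \<in> S \<Longrightarrow> t \<in> S \<Longrightarrow> s \<noteq> t \<Longrightarrow> v (s \<ominus> t) < g"
    and r: "r \<in> carrier R" "r \<noteq> \<zero>" and q: "q \<in> carrier R" "q \<noteq> \<zero>" "v r + g \<le> v q"
  shows "uncountable (cosets_in R (principal R vring r) (principal R vring q))"
proof
  let ?coset = "\<lambda>s. (\<lambda>y. r \<otimes> s \<oplus> y) ` vball (v q)"
  have S_carrier: "s \<in> carrier R" if "s \<in> S" for s using that S(2) vball_carrier by blast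
  have inj: "inj_on ?coset S"
  proof (rule inj_onI, rule ccontr)
    fix s t assume st: "s \<in> S" "t \<in> S" "?coset s = ?coset t" "s \<noteq> t"
    have closed: "r \<in> carrier R" "s \<in> carrier R" "t \<in> carrier R" using r st S_carrier by auto
    have nonzero: "s \<ominus> t \<noteq> \<zero>" using st(4) closed by simp
    have "r \<otimes> s \<ominus> r \<otimes> t \<in> vball (v q)" using st(3) closed by (simp add: vball_coset_eq_iff)
    also have "r \<otimes> s \<ominus> r \<otimes> t = r \<otimes> (s \<ominus> t)" using closed by algebra
    finally have "v q \<le> v r + v (s \<ominus> t)"
      using closed nonzero r(2) by (simp add: in_vball_iff integral_iff v_mult)
    also have "\<dots> < v r + g" using separated[OF st(1,2,4)] by simp
    finally show False using q(3) by simp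
  qed
  have "?coset ` S \<subseteq> cosets_in R (principal R vring r) (principal R vring q)"
    unfolding cosets_in_def principal_vring[OF q(1,2)] using S(2) by (auto simp: principal_def)
  moreover assume "countable (cosets_in R (principal R vring r) (principal R vring q))"
  ultimately have "countable (?coset ` S)" by (rule countable_subset)
  then show False using S(1) countable_image_inj_on[OF _ inj] by simp
qed

lemma rspan_subset_vball:
  assumes "S \<subseteq> vball g"
  shows "rspan R vring S \<subseteq> vball g"
proof
  fix x assume "x \<in> rspan R vring S"
  then obtain F c where F: "x = finsum R (\<lambda>s. c s \<otimes> s) F" "finite F" "F \<subseteq> S" "c \<in> F \<rightarrow> vring"
    unfolding rspan_def by blast
  have "finsum R (\<lambda>s. c s \<otimes> s) F \<in> vball g"
    using F(2-4)
  proof (induction F rule: finite_induct)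
    case (insert s F)
    have summand: "c t \<otimes> t \<in> vball g" if "t \<in> insert s F" for t
    proof -
      have "c t \<in> vring" "t \<in> vball g" using that insert.prems assms by auto
      then show ?thesis using vball_mult[of "c t" 0 t g] by simp
    qed
    then have "(\<lambda>s. c s \<otimes> s) \<in> F \<rightarrow> carrier R" "c s \<otimes> s \<in> carrier R" using vball_carrier by auto
    then show ?case using insert summand[of s] by (simp add: vball_add)
  qed (simp add: zero_in_vball)
  then show "x \<in> vball g" using F(1) by simp
qed

lemma rspan_carrier: "rspan R vring (carrier R) = carrier R"
proof (intro equalityI subsetI)
  fix x assume "x \<in> rspan R vring (carrier R)"
  then obtain F c where F: "x = finsum R (\<lambda>s. c s \<otimes> s) F" "F \<subseteq> carrier R" "c \<in> F \<rightarrow> vring"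
    unfolding rspan_def by blast
  then have "c s \<otimes> s \<in> carrier R" if "s \<in> F" for s using that vball_carrier by blast
  then show "x \<in> carrier R" using F(1) by (auto intro: finsum_closed)
next
  fix x assume "x \<in> carrier R"
  then show "x \<in> rspan R vring (carrier R)"
    unfolding rspan_def mem_Collect_eq
    by (intro exI[of _ "{x}"] exI[of _ "\<lambda>_. \<one>"]) (use subringE(3)[OF vring_subring] in auto)
qed

lemma residue_field_iso:
  assumes K: "ring K" and hom: "\<rho> \<in> ring_hom (R\<lparr>carrier := vring\<rparr>) K"
    and surj: "carrier K \<subseteq> \<rho> ` vring"
    and kernel: "\<And>x. x \<in> vring \<Longrightarrow> \<rho> x = \<zero>\<^bsub>K\<^esub> \<longleftrightarrow> x = \<zero> \<or> 0 < v x"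
  shows "residue_field R vring \<simeq> K"
proof -
  have "ring (R\<lparr>carrier := vring\<rparr>)" by (rule subring_is_ring[OF vring_subring])
  then interpret \<rho>: ring_hom_ring "R\<lparr>carrier := vring\<rparr>" K \<rho> using K hom by (rule ring_hom_ringI2)
  have "a_kernel (R\<lparr>carrier := vring\<rparr>) K \<rho> = max_ideal R vring"
    unfolding a_kernel_def' max_ideal_vring using kernel by (auto simp: vball_def less_imp_le)
  moreover have "\<rho> ` carrier (R\<lparr>carrier := vring\<rparr>) = carrier K"
    using surj \<rho>.hom_closed by auto
  ultimately show ?thesis unfolding residue_field_def using \<rho>.FactRing_iso by simp
qed

end

lemma field_hom_eq_zero_iff:
  assumes Q: "field Q" and F: "field F" and e: "e \<in> ring_hom Q F" and x: "x \<in> carrier Q"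
  shows "e x = \<zero>\<^bsub>F\<^esub> \<longleftrightarrow> x = \<zero>\<^bsub>Q\<^esub>"
proof -
  interpret F: field F by fact
  interpret Q: field Q by fact
  interpret e: ring_hom_ring Q F e using Q.ring_axioms F.ring_axioms e by (rule ring_hom_ringI2)
  have "e x \<noteq> \<zero>\<^bsub>F\<^esub>" if nonzero: "x \<noteq> \<zero>\<^bsub>Q\<^esub>"
  proof
    assume "e x = \<zero>\<^bsub>F\<^esub>"
    then have "e (x \<otimes>\<^bsub>Q\<^esub> inv\<^bsub>Q\<^esub> x) = \<zero>\<^bsub>F\<^esub>" using x Q.inv_of_nonzero(1)[OF x nonzero] by simp
    then show False using Q.inv_of_nonzero(3)[OF x nonzero] by simp
  qed
  then show ?thesis by auto
qed

lemma valued_field_pullback: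
  assumes F: "valued_field F v" and Q: "field Q" and e: "e \<in> ring_hom Q F"
  shows "valued_field Q (v \<circ> e)"
proof -
  interpret F: valued_field F v by fact
  interpret Q: field Q by fact
  interpret e: ring_hom_ring Q F e using Q.ring_axioms F.ring_axioms e by (rule ring_hom_ringI2)
  have nonzero: "e x \<noteq> \<zero>\<^bsub>F\<^esub>" if "x \<in> carrier Q" "x \<noteq> \<zero>\<^bsub>Q\<^esub>" for x
    using that field_hom_eq_zero_iff[OF Q F.field_axioms e] by simp
  show ?thesis
  proof
    fix x y assume xy: "x \<in> carrier Q" "x \<noteq> \<zero>\<^bsub>Q\<^esub>" "y \<in> carrier Q" "y \<noteq> \<zero>\<^bsub>Q\<^esub>"
    show "(v \<circ> e) (x \<otimes>\<^bsub>Q\<^esub> y) = (v \<circ> e) x + (v \<circ> e) y" using xy nonzero by (simp add: F.v_mult)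
    assume "x \<oplus>\<^bsub>Q\<^esub> y \<noteq> \<zero>\<^bsub>Q\<^esub>"
    then have "e x \<oplus>\<^bsub>F\<^esub> e y \<noteq> \<zero>\<^bsub>F\<^esub>" using nonzero[of "x \<oplus>\<^bsub>Q\<^esub> y"] xy by simp
    then show "min ((v \<circ> e) x) ((v \<circ> e) y) \<le> (v \<circ> e) (x \<oplus>\<^bsub>Q\<^esub> y)"
      using F.v_add[of "e x" "e y"] xy nonzero by simp
  qed
qed

section \<open>Surjective valuations\<close>

locale surj_valued_field = valued_field R v
  for R (structure) and v :: "'a \<Rightarrow> 'g::linordered_ab_group_add" +
  assumes v_surj: "\<exists>x\<in>carrier R. x \<noteq> \<zero> \<and> v x = g"
begin

definition value_class :: "'g \<Rightarrow> 'a set" where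
  "value_class g = {x \<in> carrier R. x \<noteq> \<zero> \<and> v x = g}"

definition value_rep :: "'g \<Rightarrow> 'a" where
  "value_rep g = (SOME x. x \<in> value_class g)"

lemma value_rep_in_value_class: "value_rep g \<in> value_class g"
proof -
  have "\<exists>x. x \<in> value_class g" using v_surj[of g] by (auto simp: value_class_def)
  then show ?thesis unfolding value_rep_def by (rule someI_ex)
qed

lemma value_rep: "value_rep g \<in> carrier R" "value_rep g \<noteq> \<zero>" "v (value_rep g) = g"
  using value_rep_in_value_class[of g] by (auto simp: value_class_def)

lemma inj_value_class: "inj value_class"
  by (metis injI value_rep(3) value_rep_def)

lemma r_coset_Units_vring:
  assumes x: "x \<in> carrier R" "x \<noteq> \<zero>"
  shows "Units (R\<lparr>carrier := vring\<rparr>) #>\<^bsub>mult_of R\<^esub> x = value_class (v x)"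
  unfolding r_coset_def Units_vring value_class_def
proof (intro equalityI subsetI)
  fix y assume "y \<in> {y \<in> carrier R. y \<noteq> \<zero> \<and> v y = v x}"
  then have y: "y \<in> carrier R" "y \<noteq> \<zero>" "v y = v x" by auto
  have "y = (y \<otimes> inv x) \<otimes> x" using x y inv_of_nonzero[OF x] by (simp add: m_assoc)
  moreover have "y \<otimes> inv x \<in> {z \<in> carrier R. z \<noteq> \<zero> \<and> v z = 0}"
    using x y inv_of_nonzero[OF x] by (simp add: integral_iff v_mult v_inv)
  ultimately show "y \<in> (\<Union>h\<in>{z \<in> carrier R. z \<noteq> \<zero> \<and> v z = 0}. {h \<otimes>\<^bsub>mult_of R\<^esub> x})" by auto
qed (use x in \<open>auto simp: integral_iff v_mult\<close>)

lemma carrier_value_group: "carrier (value_group R vring) = range value_class"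
proof -
  have "carrier (value_group R vring) = (\<lambda>x. value_class (v x)) ` (carrier R - {\<zero>})"
    unfolding value_group_def FactGroup_def RCOSETS_def using r_coset_Units_vring by auto
  also have "\<dots> = range value_class"
    using value_rep by (auto intro!: image_eqI[where x = "value_rep _"])
  finally show ?thesis .
qed

lemma mult_value_group:
  "value_class g \<otimes>\<^bsub>value_group R vring\<^esub> value_class h = value_class (g + h)"
proof -
  have "value_class g <#>\<^bsub>mult_of R\<^esub> value_class h = value_class (g + h)"
  proof (intro equalityI subsetI)
    fix z assume "z \<in> value_class g <#>\<^bsub>mult_of R\<^esub> value_class h"
    then show "z \<in> value_class (g + h)"
      by (auto simp: set_mult_def value_class_def integral_iff v_mult)
  next
    fix z assume "z \<in> value_class (g + h)"
    then have z: "z \<in> carrier R" "z \<noteq> \<zero>" "v z = g + h" by (auto simp: value_class_def)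
    let ?x = "value_rep g"
    note inv = inv_of_nonzero[OF value_rep(1,2), of g]
    have "z = ?x \<otimes> (inv ?x \<otimes> z)" using z value_rep inv by (simp add: m_assoc[symmetric])
    moreover have "inv ?x \<otimes> z \<in> value_class h"
      using z value_rep inv by (simp add: value_class_def integral_iff v_mult v_inv)
    ultimately show "z \<in> value_class g <#>\<^bsub>mult_of R\<^esub> value_class h"
      using value_rep_in_value_class unfolding set_mult_def by auto
  qed
  then show ?thesis by (simp add: value_group_def FactGroup_def)
qed

lemma value_le_value_class: "value_le R vring (value_class g) (value_class h) \<longleftrightarrow> g \<le> h"
proof -
  have "y \<otimes> inv x \<in> vring \<longleftrightarrow> g \<le> h" if "x \<in> value_class g" "y \<in> value_class h" for x y
    using that inv_of_nonzero[of x]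
    by (auto simp: value_class_def in_vball_iff integral_iff v_mult v_inv)
  then show ?thesis
    unfolding value_le_def using value_rep_in_value_class by blast
qed

end

lemma same_value_group_vring:
  fixes v :: "'a \<Rightarrow> 'g::linordered_ab_group_add" and w :: "'b \<Rightarrow> 'g"
  assumes Q: "surj_valued_field Q v" and Q': "surj_valued_field Q' w"
  shows "same_value_group Q (valued_field.vball Q v 0) Q' (valued_field.vball Q' w 0)"
proof -
  interpret V: surj_valued_field Q v by (rule Q)
  interpret W: surj_valued_field Q' w by (rule Q')
  define \<phi> where "\<phi> = W.value_class \<circ> inv_into UNIV V.value_class"
  have \<phi>: "\<phi> (V.value_class g) = W.value_class g" for g by (simp add: \<phi>_def V.inj_value_class)
  have "\<phi> \<in> iso (value_group Q V.vring) (value_group Q' W.vring)"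
    unfolding iso_def hom_def mem_Collect_eq V.carrier_value_group W.carrier_value_group
  proof (intro conjI)
    show "bij_betw \<phi> (range V.value_class) (range W.value_class)"
      by (rule bij_betw_imageI) (auto simp: \<phi> image_image inj_eq[OF W.inj_value_class] intro: inj_onI)
  qed (auto simp: \<phi> V.mult_value_group W.mult_value_group)
  moreover have "value_le Q V.vring A B \<longleftrightarrow> value_le Q' W.vring (\<phi> A) (\<phi> B)"
    if "A \<in> range V.value_class" "B \<in> range V.value_class" for A B
    using that by (auto simp: \<phi> V.value_le_value_class W.value_le_value_class)
  ultimately show ?thesis unfolding same_value_group_def V.carrier_value_group by blast
qed

section \<open>Value groups of cofinality aleph one\<close>

lemma Cinfinite_aleph1: "Cinfinite aleph1"
  by (rule Cinfinite_cardSuc[OF natLeq_Cinfinite])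

lemma countable_iff_ordLess_aleph1: "countable A \<longleftrightarrow> |A| <o aleph1"
  by (simp add: countable_card_le_natLeq cardSuc_ordLeq_ordLess natLeq_Card_order)

lemma card_of_omega1_idx: "|omega1_idx| =o aleph1"
  using Cinfinite_aleph1 by (intro card_of_Field_ordIso) simp

lemma uncountable_omega1_idx: "uncountable omega1_idx"
  using card_of_omega1_idx not_ordLess_ordIso countable_iff_ordLess_aleph1 by blast

text \<open>The members of \<open>omega1_idx\<close> happen to be sets of natural numbers, which provides \<open>\<aleph>\<^sub>1\<close> sets of
  exponents.\<close>

lemma uncountable_images_omega1_idx:
  fixes s :: "nat \<Rightarrow> 'a"
  assumes "inj s"
  shows "uncountable ((`) s ` omega1_idx)"
proof -
  have "inj_on ((`) s) omega1_idx" using assms by (simp add: inj_on_def inj_image_eq_iff)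
  then show ?thesis using uncountable_omega1_idx countable_image_inj_on by blast
qed

lemma countable_underS_aleph1: "i \<in> omega1_idx \<Longrightarrow> countable (underS aleph1 i)"
  unfolding countable_iff_ordLess_aleph1 using Cinfinite_aleph1 by (intro card_of_underS) auto

lemma linear_order_aleph1: "linear_order_on omega1_idx aleph1"
  using Cinfinite_aleph1 unfolding card_order_on_def well_order_on_def by simp

lemma aleph1_total: "i \<in> omega1_idx \<Longrightarrow> j \<in> omega1_idx \<Longrightarrow> i \<noteq> j \<Longrightarrow> (i, j) \<in> aleph1 \<or> (j, i) \<in> aleph1"
  using linear_order_aleph1 by (auto simp: order_on_defs total_on_def)

lemma countable_omega1_idx_bounded:
  assumes C: "countable C" "C \<subseteq> omega1_idx"
  obtains j where "j \<in> omega1_idx" "\<And>i. i \<in> C \<Longrightarrow> (i, j) \<in> aleph1 \<and> i \<noteq> j"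
proof -
  have "countable (\<Union>i\<in>C. insert i (underS aleph1 i))"
    using C countable_underS_aleph1 by (intro countable_UN countable_insert) auto
  then obtain j where j: "j \<in> omega1_idx" "j \<notin> (\<Union>i\<in>C. insert i (underS aleph1 i))"
    using uncountable_omega1_idx by (meson countable_subset subsetI)
  then have "(i, j) \<in> aleph1 \<and> i \<noteq> j" if "i \<in> C" for i
    using that C(2) aleph1_total[of i j] by (auto simp: underS_def)
  then show thesis using that j(1) by blast
qed

locale aleph1_valued_field = surj_valued_field R v
  for R (structure) and v :: "'a \<Rightarrow> 'g::linordered_ab_group_add" +
  fixes u :: "nat set \<Rightarrow> 'g"
  assumes card_of_carrier: "|carrier R| \<le>o aleph1"
    and u_pos: "i \<in> omega1_idx \<Longrightarrow> 0 < u i"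
    and u_less: "(i, j) \<in> aleph1 \<Longrightarrow> i \<noteq> j \<Longrightarrow> u i < u j"
    and u_cofinal: "\<exists>i\<in>omega1_idx. g < u i"
begin

lemma inj_on_u: "inj_on u omega1_idx"
  using aleph1_total u_less by (intro inj_onI) (metis less_irrefl)

lemma countable_values_bounded:
  assumes "countable C"
  obtains i where "i \<in> omega1_idx" "\<And>g. g \<in> C \<Longrightarrow> g < u i"
proof -
  obtain f where f: "\<And>g. f g \<in> omega1_idx" "\<And>g. g < u (f g)" using u_cofinal by metis
  have "countable (f ` C)" "f ` C \<subseteq> omega1_idx" using assms f by auto
  then obtain i where i: "i \<in> omega1_idx" "\<And>j. j \<in> f ` C \<Longrightarrow> (j, i) \<in> aleph1 \<and> j \<noteq> i"
    using countable_omega1_idx_bounded by metis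
  have "g < u i" if "g \<in> C" for g
    using f(2)[of g] u_less[of "f g" i] i(2)[of "f g"] that by (auto intro: less_trans)
  then show thesis using that i(1) by blast
qed

lemma ex_omega1_idx: "\<exists>i. i \<in> omega1_idx"
  using u_cofinal by blast

lemma valuation_domain_in_vring: "valuation_domain_in R vring"
proof -
  obtain i where "i \<in> omega1_idx" using ex_omega1_idx by blast
  then have "value_rep (- u i) \<notin> vring"
    using value_rep[of "- u i"] u_pos by (auto simp: in_vball_iff not_le)
  then show ?thesis by (rule valuation_domain_in_vringI[OF value_rep(1)])
qed

lemma card_eq_aleph1_vring: "card_eq_aleph1 vring"
proof -
  have "|vring| \<le>o aleph1"
    by (rule card_of_subset_ordLeq[OF _ card_of_carrier]) (auto simp: vball_carrier)
  moreover have "|omega1_idx| \<le>o |vring|"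
  proof (rule card_of_ordLeqI)
    show "inj_on (\<lambda>i. value_rep (u i)) omega1_idx"
      using inj_on_u value_rep(3) by (metis (mono_tags, lifting) inj_on_def)
    show "value_rep (u i) \<in> vring" if "i \<in> omega1_idx" for i
      using that u_pos value_rep[of "u i"] by (simp add: in_vball_iff less_imp_le)
  qed
  then have "aleph1 \<le>o |vring|"
    by (rule ordIso_ordLeq_trans[OF ordIso_symmetric[OF card_of_omega1_idx]])
  ultimately show ?thesis unfolding card_eq_aleph1_def by (simp add: ordIso_iff_ordLeq)
qed

lemma ex_generators_card_le_aleph1: "\<exists>S\<subseteq>carrier R. card_le_aleph1 S \<and> rspan R vring S = carrier R"
  using card_of_carrier rspan_carrier unfolding card_le_aleph1_def by blast

lemma not_countably_generated:
  assumes S: "S \<subseteq> carrier R" "countable S"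
  shows "rspan R vring S \<noteq> carrier R"
proof
  assume span: "rspan R vring S = carrier R"
  obtain i where i: "i \<in> omega1_idx" "\<And>g. g \<in> (\<lambda>s. - v s) ` S \<Longrightarrow> g < u i"
    using countable_values_bounded[OF countable_image[OF S(2)]] by blast
  have "s \<in> vball (- u i)" if "s \<in> S" for s
  proof -
    have "- v s < u i" using that i(2) by blast
    then have "- u i \<le> v s" by (subst minus_le_iff) (rule less_imp_le)
    then show ?thesis using that S(1) by (auto simp: vball_def)
  qed
  then have "carrier R \<subseteq> vball (- u i)" using rspan_subset_vball span by blast
  then have "- u i \<le> - u i - u i"
    using value_rep[of "- u i - u i"] by (metis in_vball_iff subsetD)
  then show False using u_pos[OF i(1)] by simp
qed

lemma ex_omega1_rep: "\<exists>r. omega1_rep R vring (carrier R) r"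
proof
  let ?r = "\<lambda>i. value_rep (u i)"
  have rdvd: "rdvd R vring (?r i) (?r j) \<longleftrightarrow> u i \<le> u j" for i j
    using value_rep by (simp add: rdvd_vring in_vball_iff)
  have principal: "principal R vring (inv (?r i)) = vball (- u i)" for i
    using inv_of_nonzero[OF value_rep(1,2)] value_rep by (simp add: principal_vring v_inv)
  show "omega1_rep R vring (carrier R) ?r"
    unfolding omega1_rep_def rdvd principal
  proof (intro conjI ballI impI)
    show "?r i \<in> vring" if "i \<in> omega1_idx" for i
      using value_rep[of "u i"] u_pos[OF that] by (simp add: in_vball_iff less_imp_le)
    show "?r i \<noteq> \<zero>" for i by (rule value_rep)
    show "u j \<le> u i" "\<not> u i \<le> u j" if "(j, i) \<in> aleph1 \<and> j \<noteq> i" for i j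
      using u_less[of j i] that by auto
    have "\<exists>i\<in>omega1_idx. x \<in> vball (- u i)" if "x \<in> carrier R" for x
    proof -
      obtain i where i: "i \<in> omega1_idx" "- v x < u i" using u_cofinal by blast
      then have "- u i \<le> v x" by (subst minus_le_iff) (rule less_imp_le)
      then show ?thesis using that i(1) by (auto simp: vball_def)
    qed
    then show "carrier R = (\<Union>i\<in>omega1_idx. vball (- u i))" using vball_carrier by blast
  qed
qed

lemma omega1_rep_closed:
  assumes "omega1_rep R vring (carrier R) r" "i \<in> omega1_idx"
  shows "r i \<in> carrier R" "r i \<noteq> \<zero>"
  using assms vball_carrier by (auto simp: omega1_rep_def)

lemma omega1_rep_less:
  assumes r: "omega1_rep R vring (carrier R) r" and ij: "i \<in> omega1_idx" "j \<in> omega1_idx"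
    and less: "v (r i) < v (r j)"
  shows "(i, j) \<in> aleph1 \<and> i \<noteq> j"
proof -
  have "\<not> rdvd R vring (r j) (r i)"
    using less omega1_rep_closed[OF r] ij by (simp add: rdvd_vring in_vball_iff)
  then have "(j, i) \<notin> aleph1 \<or> j = i" using r ij unfolding omega1_rep_def by blast
  moreover have "i \<noteq> j" using less by auto
  ultimately show ?thesis using aleph1_total ij by blast
qed

lemma omega1_rep_cofinal:
  assumes r: "omega1_rep R vring (carrier R) r"
  obtains j where "j \<in> omega1_idx" "g \<le> v (r j)"
proof -
  have "value_rep (- g) \<in> (\<Union>j\<in>omega1_idx. principal R vring (inv (r j)))"
    using r value_rep(1) unfolding omega1_rep_def by blast
  then obtain j where j: "j \<in> omega1_idx" "value_rep (- g) \<in> principal R vring (inv (r j))" by blast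
  have "g \<le> v (r j)"
    using j(2) value_rep[of "- g"] omega1_rep_closed[OF r j(1)] inv_of_nonzero[of "r j"]
    by (simp add: principal_vring in_vball_iff v_inv)
  then show thesis using that j(1) by blast
qed

lemma essentially_uncountable_type_vring:
  assumes S: "uncountable S" "S \<subseteq> vring"
    and separated: "\<And>s t. s \<in> S \<Longrightarrow> t \<in> S \<Longrightarrow> s \<noteq> t \<Longrightarrow> v (s \<ominus> t) < g"
  shows "essentially_uncountable_type R vring (carrier R)"
  unfolding essentially_uncountable_type_def
proof (intro conjI allI impI ballI)
  fix r i assume r: "omega1_rep R vring (carrier R) r" and i: "i \<in> omega1_idx"
  obtain k where k: "k \<in> omega1_idx" "g < u k" using u_cofinal by blast
  obtain j where j: "j \<in> omega1_idx" "v (r i) + u k \<le> v (r j)" using omega1_rep_cofinal[OF r] .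
  have "v (r i) < v (r i) + u k" using u_pos[OF k(1)] by simp
  also note j(2)
  finally have "(i, j) \<in> aleph1 \<and> i \<noteq> j" by (rule omega1_rep_less[OF r i j(1)])
  moreover have "v (r i) + g \<le> v (r i) + u k" using k(2) by simp
  then have "v (r i) + g \<le> v (r j)" using j(2) by (rule order_trans)
  then have "uncountable (cosets_in R (principal R vring (r i)) (principal R vring (r j)))"
    using omega1_rep_closed[OF r] i j(1)
    by (intro uncountable_cosets_in_if_separated[OF S separated]) auto
  ultimately show "\<exists>j\<in>omega1_idx. (i, j) \<in> aleph1 \<and> i \<noteq> j \<and>
      uncountable (cosets_in R (principal R vring (r i)) (principal R vring (r j)))"
    using j(1) by (intro bexI[of _ j]) simp_all
qed (rule ex_omega1_rep)

lemma strongly_countable_type_vring: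
  fixes c :: "'g \<Rightarrow> 'a \<Rightarrow> 'c"
  assumes range: "\<And>g. countable (c g ` vring)"
    and fibres: "\<And>g x y. x \<in> vring \<Longrightarrow> y \<in> vring \<Longrightarrow> c g x = c g y \<Longrightarrow> x \<ominus> y \<in> vball g"
  shows "strongly_countable_type R vring (carrier R)"
  unfolding strongly_countable_type_def
proof (intro conjI allI impI ballI)
  fix r i assume r: "omega1_rep R vring (carrier R) r" and i: "i \<in> omega1_idx"
  let ?coset = "\<lambda>x. (\<lambda>y. x \<oplus> y) ` vball (v (r i))"
  define rep where "rep = inv_into vring (c (v (r i)))"
  have "?coset x = ?coset (rep (c (v (r i)) x))" if x: "x \<in> vring" for x
  proof -
    have rep: "rep (c (v (r i)) x) \<in> vring" "c (v (r i)) (rep (c (v (r i)) x)) = c (v (r i)) x"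
      using x by (simp_all add: rep_def inv_into_into f_inv_into_f)
    then have "x \<ominus> rep (c (v (r i)) x) \<in> vball (v (r i))" using fibres x by metis
    then show ?thesis using vball_coset_eq_iff vball_carrier x rep(1) by blast
  qed
  then have "cosets_in R vring (principal R vring (r i)) \<subseteq> (\<lambda>z. ?coset (rep z)) ` c (v (r i)) ` vring"
    unfolding cosets_in_def principal_vring[OF omega1_rep_closed[OF r i]] by blast
  then show "countable (cosets_in R vring (principal R vring (r i)))"
    by (rule countable_subset) (use range in simp)
qed (rule ex_omega1_rep)

end

section \<open>Well-ordered subsets of ordered groups\<close>

lemma lift_Suc_antimono_less:
  fixes f :: "nat \<Rightarrow> 'a::order"
  assumes step: "\<And>n. f (Suc n) < f n" and "m < n"
  shows "f n < f m"
  using \<open>m < n\<close> by (induction m n rule: less_Suc_induct) (auto intro: step less_trans)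

lemma wfp_on_less_iff_ex_least:
  fixes S :: "'g::linorder set"
  shows "wfp_on S (<) \<longleftrightarrow> (\<forall>T\<subseteq>S. T \<noteq> {} \<longrightarrow> (\<exists>m\<in>T. \<forall>t\<in>T. m \<le> t))"
proof -
  have "(\<forall>y. y < m \<longrightarrow> y \<notin> T) \<longleftrightarrow> (\<forall>t\<in>T. m \<le> t)" for m :: 'g and T by (auto simp flip: not_less)
  then show ?thesis by (simp add: wfp_on_iff_ex_minimal)
qed

lemma wfp_on_less_least:
  fixes S :: "'g::linorder set"
  assumes "wfp_on S (<)" "T \<subseteq> S" "T \<noteq> {}"
  obtains m where "m \<in> T" "\<And>t. t \<in> T \<Longrightarrow> m \<le> t"
  using assms unfolding wfp_on_less_iff_ex_least by metis

lemma wfp_on_less_ex_least_term: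
  fixes s :: "nat \<Rightarrow> 'g::linorder"
  assumes "wfp_on S (<)" "range s \<subseteq> S"
  obtains m where "\<And>n. s m \<le> s n"
  using assms(1)[unfolded wfp_on_less_iff_ex_least, rule_format, of "range s"] assms(2) by auto

lemma wfp_on_less_iff_not_descending:
  fixes S :: "'g::linorder set"
  shows "wfp_on S (<) \<longleftrightarrow> (\<forall>s :: nat \<Rightarrow> 'g. range s \<subseteq> S \<longrightarrow> (\<exists>n. s n \<le> s (Suc n)))"
proof
  assume S: "wfp_on S (<)"
  show "\<forall>s :: nat \<Rightarrow> 'g. range s \<subseteq> S \<longrightarrow> (\<exists>n. s n \<le> s (Suc n))"
    by (metis wfp_on_less_ex_least_term[OF S])
next
  assume no_descent: "\<forall>s :: nat \<Rightarrow> 'g. range s \<subseteq> S \<longrightarrow> (\<exists>n. s n \<le> s (Suc n))"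
  show "wfp_on S (<)"
    unfolding wfp_on_less_iff_ex_least
  proof (intro allI impI, rule ccontr)
    fix T assume T: "T \<subseteq> S" "T \<noteq> {}" "\<not> (\<exists>m\<in>T. \<forall>t\<in>T. m \<le> t)"
    then have "\<exists>x. x \<in> T" "\<And>x. x \<in> T \<Longrightarrow> \<exists>y. y \<in> T \<and> y < x" by (auto simp: not_le)
    then obtain s where "\<And>n. s n \<in> T" "\<And>n. s (Suc n) < s n"
      using dependent_nat_choice[of "\<lambda>_ x. x \<in> T" "\<lambda>_ x y. y < x"] by blast
    then show False using no_descent T(1) by (metis image_subsetI not_le subsetD)
  qed
qed

lemma wfp_on_less_finite:
  fixes S :: "'g::linorder set"
  shows "finite S \<Longrightarrow> wfp_on S (<)"
  unfolding wfp_on_less_iff_ex_least by (metis Min_in Min_le finite_subset)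

lemma wfp_on_less_range_strict_mono:
  fixes s :: "nat \<Rightarrow> 'g::linorder"
  shows "strict_mono s \<Longrightarrow> wfp_on (range s) (<)"
  by (simp add: wfp_on_image strict_mono_less)

lemma wfp_on_less_incseq_subseq:
  fixes s :: "nat \<Rightarrow> 'g::linorder"
  assumes S: "wfp_on S (<)" and s: "range s \<subseteq> S"
  obtains \<phi> :: "nat \<Rightarrow> nat" where "strict_mono \<phi>" "incseq (\<lambda>n. s (\<phi> n))"
proof -
  obtain \<phi> :: "nat \<Rightarrow> nat" where \<phi>: "strict_mono \<phi>" "monoseq (\<lambda>n. s (\<phi> n))"
    using seq_monosub by blast
  consider "incseq (\<lambda>n. s (\<phi> n))" | "decseq (\<lambda>n. s (\<phi> n))"
    using \<phi>(2) unfolding monoseq_iff by blast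
  then show thesis
  proof cases
    case 1
    then show thesis using that \<phi>(1) by blast
  next
    case 2
    have "range (\<lambda>n. s (\<phi> n)) \<subseteq> S" using s by auto
    then obtain N where least: "\<And>n. s (\<phi> N) \<le> s (\<phi> n)"
      using wfp_on_less_ex_least_term[OF S, of "\<lambda>n. s (\<phi> n)"] by blast
    have "s (\<phi> (n + N)) = s (\<phi> N)" for n
      using decseqD[OF 2, of N "n + N"] least by (simp add: antisym)
    moreover have "strict_mono (\<lambda>n. \<phi> (n + N))" using \<phi>(1) by (simp add: strict_mono_def)
    ultimately show thesis using that[of "\<lambda>n. \<phi> (n + N)"] by simp
  qed
qed

lemma wfp_on_less_Un:
  fixes S T :: "'g::linorder set"
  assumes "wfp_on S (<)" "wfp_on T (<)"
  shows "wfp_on (S \<union> T) (<)"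
  unfolding wfp_on_less_iff_ex_least
proof (intro allI impI)
  fix U assume U: "U \<subseteq> S \<union> T" "U \<noteq> {}"
  show "\<exists>m\<in>U. \<forall>t\<in>U. m \<le> t"
  proof (cases "U \<inter> S = {} \<or> U \<inter> T = {}")
    case True
    then have "U \<subseteq> S \<or> U \<subseteq> T" using U by blast
    then show ?thesis using assms U(2) by (auto simp: wfp_on_less_iff_ex_least)
  next
    case False
    obtain m where m: "m \<in> U \<inter> S" "\<forall>t\<in>U \<inter> S. m \<le> t"
      using assms(1) False unfolding wfp_on_less_iff_ex_least by (metis inf_le2)
    obtain n where n: "n \<in> U \<inter> T" "\<forall>t\<in>U \<inter> T. n \<le> t"
      using assms(2) False unfolding wfp_on_less_iff_ex_least by (metis inf_le2)
    have "min m n \<le> t" if "t \<in> U" for t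
      using that m(2) n(2) U(1) by (cases "t \<in> S") (auto intro: min.coboundedI1 min.coboundedI2)
    moreover have "min m n \<in> U" using m(1) n(1) by (simp add: min_def)
    ultimately show ?thesis by blast
  qed
qed

lemma finite_fibre_of_sums:
  fixes S T :: "'g::linordered_ab_group_add set"
  assumes S: "wfp_on S (<)" and T: "wfp_on T (<)"
  shows "finite {a \<in> S. g - a \<in> T}"
proof (rule ccontr)
  assume "infinite {a \<in> S. g - a \<in> T}"
  then obtain s :: "nat \<Rightarrow> 'g" where s: "inj s" "range s \<subseteq> {a \<in> S. g - a \<in> T}"
    using infinite_countable_subset by blast
  obtain \<phi> :: "nat \<Rightarrow> nat" where \<phi>: "strict_mono \<phi>" "incseq (\<lambda>n. s (\<phi> n))"
    using wfp_on_less_incseq_subseq[OF S, of s] s(2) by blast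
  obtain n where "g - s (\<phi> n) \<le> g - s (\<phi> (Suc n))"
    using T[unfolded wfp_on_less_iff_not_descending, rule_format, of "\<lambda>n. g - s (\<phi> n)"] s(2) by blast
  then have "s (\<phi> n) = s (\<phi> (Suc n))" using incseq_SucD[OF \<phi>(2), of n] by (simp add: antisym)
  then show False using s(1) \<phi>(1) by (simp add: inj_eq strict_mono_eq)
qed

lemma wfp_on_less_sums:
  fixes S T :: "'g::linordered_ab_group_add set"
  assumes S: "wfp_on S (<)" and T: "wfp_on T (<)"
  shows "wfp_on {a + b | a b. a \<in> S \<and> b \<in> T} (<)"
  unfolding wfp_on_less_iff_not_descending
proof (intro allI impI, rule ccontr)
  fix s :: "nat \<Rightarrow> 'g"
  assume "range s \<subseteq> {a + b | a b. a \<in> S \<and> b \<in> T}"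
  then have "\<forall>n. \<exists>a b. s n = a + b \<and> a \<in> S \<and> b \<in> T" by blast
  then obtain a b where ab: "\<And>n. s n = a n + b n" "range a \<subseteq> S" "range b \<subseteq> T"
    by (metis image_subsetI)
  assume "\<nexists>n. s n \<le> s (Suc n)"
  then have "s (Suc n) < s n" for n by (simp add: not_le)
  then have desc: "s n < s m" if "m < n" for m n using that by (rule lift_Suc_antimono_less)
  obtain \<phi> :: "nat \<Rightarrow> nat" where \<phi>: "strict_mono \<phi>" "incseq (\<lambda>n. a (\<phi> n))"
    using wfp_on_less_incseq_subseq[OF S ab(2)] .
  obtain n where n: "b (\<phi> n) \<le> b (\<phi> (Suc n))"
    using T[unfolded wfp_on_less_iff_not_descending, rule_format, of "\<lambda>n. b (\<phi> n)"] ab(3) by blast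
  have "s (\<phi> n) \<le> s (\<phi> (Suc n))"
    unfolding ab(1) by (intro add_mono n incseq_SucD[OF \<phi>(2)])
  then show False using desc[of "\<phi> n" "\<phi> (Suc n)"] \<phi>(1) by (simp add: strict_mono_less)
qed

lemma ex_descending_sequence:
  fixes f :: "'a \<Rightarrow> 'b::linorder"
  assumes "\<not> wfp_on (f ` A) (<)"
  obtains s :: "nat \<Rightarrow> 'a" where "range s \<subseteq> A" "\<forall>n. f (s (Suc n)) < f (s n)"
proof -
  have "\<exists>d :: nat \<Rightarrow> 'b. range d \<subseteq> f ` A \<and> (\<forall>n. d (Suc n) < d n)"
    using assms by (simp add: wfp_on_less_iff_not_descending not_le)
  then obtain d :: "nat \<Rightarrow> 'b" where d: "range d \<subseteq> f ` A" "\<forall>n. d (Suc n) < d n" by blast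
  define s where "s n = inv_into A f (d n)" for n
  have d_image: "d n \<in> f ` A" for n using d(1) by blast
  have "range s \<subseteq> A" using inv_into_into[OF d_image] by (auto simp: s_def)
  moreover have "\<forall>n. f (s (Suc n)) < f (s n)" using d(2) by (simp add: s_def f_inv_into_f[OF d_image])
  ultimately show thesis by (rule that)
qed

lemma minimal_descending_sequence:
  fixes f :: "'a \<Rightarrow> 'b::linorder" and size :: "'a \<Rightarrow> nat"
  assumes not_wf: "\<not> wfp_on (f ` A) (<)"
  obtains s where "range s \<subseteq> A" "\<forall>n. f (s (Suc n)) < f (s n)"
    "\<forall>n t. range t \<subseteq> A \<longrightarrow> (\<forall>k. f (t (Suc k)) < f (t k)) \<longrightarrow> f (t 0) < f (s n) \<longrightarrow>
      size (s (Suc n)) \<le> size (t 0)"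
proof -
  define bad where "bad x \<longleftrightarrow> (\<exists>t. t 0 = x \<and> range t \<subseteq> A \<and> (\<forall>k. f (t (Suc k)) < f (t k)))" for x
  define smallest_below where "smallest_below x y \<longleftrightarrow>
    f y < f x \<and> (\<forall>z. bad z \<and> f z < f x \<longrightarrow> size y \<le> size z)" for x y
  have badI: "bad (t 0)" if "range t \<subseteq> A" "\<forall>k. f (t (Suc k)) < f (t k)" for t
    unfolding bad_def using that by (intro exI[of _ t]) simp
  have bad_A: "x \<in> A" if "bad x" for x using that unfolding bad_def by auto
  have ex_smallest_below: "\<exists>y. bad y \<and> smallest_below x y" if "bad x" for x
  proof -
    obtain t where t: "t 0 = x" "range t \<subseteq> A" "\<forall>k. f (t (Suc k)) < f (t k)"
      using \<open>bad x\<close> unfolding bad_def by blast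
    have "bad (t (Suc 0))" using badI[of "\<lambda>k. t (Suc k)"] t(2,3) by auto
    moreover have "f (t (Suc 0)) < f x" using t(1,3) by auto
    ultimately show ?thesis
      using ex_has_least_nat[of "\<lambda>y. bad y \<and> f y < f x" "t (Suc 0)" size]
      unfolding smallest_below_def by simp
  qed
  obtain t where "range t \<subseteq> A" "\<forall>k. f (t (Suc k)) < f (t k)"
    using not_wf by (rule ex_descending_sequence)
  then have "bad (t 0)" by (rule badI)
  then have "\<exists>x. bad x" ..
  then have "\<exists>s. \<forall>n. bad (s n) \<and> smallest_below (s n) (s (Suc n))"
    using ex_smallest_below by (rule dependent_nat_choice)
  then obtain s where s: "\<And>n. bad (s n)" "\<And>n. smallest_below (s n) (s (Suc n))" by blast
  show thesis
  proof (rule that[of s])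
    show "range s \<subseteq> A" using bad_A[OF s(1)] by auto
    show "\<forall>n. f (s (Suc n)) < f (s n)" using s(2) by (simp add: smallest_below_def)
    show "\<forall>n t. range t \<subseteq> A \<longrightarrow> (\<forall>k. f (t (Suc k)) < f (t k)) \<longrightarrow> f (t 0) < f (s n) \<longrightarrow>
        size (s (Suc n)) \<le> size (t 0)"
      using s(2) badI by (simp add: smallest_below_def)
  qed
qed

text \<open>Neumann's lemma. In a minimal descending sequence of sums, deleting the first summands along a
  subsequence on which these summands increase leaves a descending sequence that starts with a
  shorter word.\<close>

lemma wfp_on_less_sum_lists:
  fixes S :: "'g::linordered_ab_group_add set"
  assumes S: "wfp_on S (<)" and pos: "\<And>a. a \<in> S \<Longrightarrow> 0 < a"
  shows "wfp_on (sum_list ` lists S) (<)"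
proof (rule ccontr)
  assume "\<not> wfp_on (sum_list ` lists S) (<)"
  then obtain w where w_S: "range w \<subseteq> lists S"
    and "\<forall>n. sum_list (w (Suc n)) < sum_list (w n)"
    and shortest: "\<forall>n t. range t \<subseteq> lists S \<longrightarrow> (\<forall>k. sum_list (t (Suc k)) < sum_list (t k)) \<longrightarrow>
      sum_list (t 0) < sum_list (w n) \<longrightarrow> length (w (Suc n)) \<le> length (t 0)"
    by (rule minimal_descending_sequence[where size = length])
  then have w_step: "sum_list (w (Suc n)) < sum_list (w n)" for n by blast
  have letters: "set (w n) \<subseteq> S" for n using w_S by auto
  have "0 \<le> sum_list (w n)" for n
    using letters[of n] pos by (intro sum_list_nonneg less_imp_le) auto
  then have "w n \<noteq> []" for n using w_step[of n] by (metis leD sum_list.Nil)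
  define a v where "a n = hd (w (Suc n))" and "v n = tl (w (Suc n))" for n
  have av: "w (Suc n) = a n # v n" for n using \<open>w (Suc n) \<noteq> []\<close> by (simp add: a_def v_def)
  have a_S: "a n \<in> S" and v_S: "v n \<in> lists S" for n using letters[of "Suc n"] by (auto simp: av)
  obtain \<phi> :: "nat \<Rightarrow> nat" where \<phi>: "strict_mono \<phi>" "incseq (\<lambda>n. a (\<phi> n))"
    using wfp_on_less_incseq_subseq[OF S, of a] a_S by blast
  have w_desc: "sum_list (w n) < sum_list (w m)" if "m < n" for m n
    using w_step that by (rule lift_Suc_antimono_less)
  have v_step: "sum_list (v (\<phi> (Suc n))) < sum_list (v (\<phi> n))" for n
  proof -
    have "a (\<phi> (Suc n)) + sum_list (v (\<phi> (Suc n))) < a (\<phi> n) + sum_list (v (\<phi> n))"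
      using w_desc[of "Suc (\<phi> n)" "Suc (\<phi> (Suc n))"] \<phi>(1) by (simp add: av strict_mono_less)
    also have "\<dots> \<le> a (\<phi> (Suc n)) + sum_list (v (\<phi> n))"
      using incseq_SucD[OF \<phi>(2)] by (rule add_right_mono)
    finally show ?thesis by simp
  qed
  have "sum_list (v (\<phi> 0)) < sum_list (w (Suc (\<phi> 0)))" using pos[OF a_S] by (simp add: av)
  also have "\<dots> < sum_list (w (\<phi> 0))" by (rule w_step)
  finally have "length (w (Suc (\<phi> 0))) \<le> length (v (\<phi> 0))"
    using shortest[rule_format, of "\<lambda>n. v (\<phi> n)" "\<phi> 0"] v_S v_step by auto
  then show False by (simp add: av)
qed

lemma add_mem_sum_lists: "a \<in> S \<Longrightarrow> x \<in> sum_list ` lists S \<Longrightarrow> a + x \<in> sum_list ` lists S"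
  for a :: "'g::monoid_add"
  by (auto intro!: image_eqI[where x = "a # _"])

lemma wfp_on_less_recursion:
  fixes F :: "('g::linorder \<Rightarrow> 'a) \<Rightarrow> 'g \<Rightarrow> 'a"
  assumes W: "wfp_on W (<)"
    and closed: "\<And>k g. g \<in> W \<Longrightarrow> (\<And>x. x \<in> W \<Longrightarrow> x < g \<Longrightarrow> k x \<in> D) \<Longrightarrow> F k g \<in> D"
    and cong: "\<And>k k' g. g \<in> W \<Longrightarrow> (\<And>x. x \<in> W \<Longrightarrow> x < g \<Longrightarrow> k x \<in> D \<and> k x = k' x) \<Longrightarrow> F k g = F k' g"
  obtains h where "\<And>g. g \<in> W \<Longrightarrow> h g \<in> D" "\<And>g. g \<in> W \<Longrightarrow> h g = F h g"
proof -
  define r where "r = {(x, y). x < y \<and> x \<in> W \<and> y \<in> W}"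
  have wf: "wf r" using iffD1[OF wfp_on_iff_wfp W] by (simp only: r_def wfp_def)
  define h where "h = wfrec r F"
  have unfold: "h g = F (cut h r g) g" for g unfolding h_def by (rule wfrec[OF wf])
  have below: "cut h r g x = h x" if "g \<in> W" "x \<in> W" "x < g" for g x
    using that by (simp add: cut_def r_def)
  have h_closed: "h g \<in> D" if "g \<in> W" for g
  proof (rule wfp_on_induct[OF W that])
    fix g assume g: "g \<in> W" and IH: "\<And>x. x \<in> W \<Longrightarrow> x < g \<Longrightarrow> h x \<in> D"
    have "F (cut h r g) g \<in> D" by (rule closed[OF g]) (simp add: below g IH)
    then show "h g \<in> D" by (simp only: unfold[of g])
  qed
  moreover have "h g = F h g" if g: "g \<in> W" for g
  proof -
    have "F (cut h r g) g = F h g" by (rule cong[OF g]) (simp add: below g h_closed)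
    then show ?thesis by (simp only: unfold[of g])
  qed
  ultimately show thesis by (rule that)
qed

section \<open>Hahn series\<close>

definition convex_subgroup :: "'g::linordered_ab_group_add set \<Rightarrow> bool" where
  "convex_subgroup D \<longleftrightarrow> 0 \<in> D \<and> (\<forall>x\<in>D. \<forall>y\<in>D. x - y \<in> D) \<and> (\<forall>x\<in>D. \<forall>y. 0 \<le> y \<longrightarrow> y \<le> x \<longrightarrow> y \<in> D)"

lemma convex_subgroup_add:
  assumes "convex_subgroup D" "x \<in> D" "y \<in> D"
  shows "x + y \<in> D"
proof -
  have "x - (0 - y) \<in> D" using assms unfolding convex_subgroup_def by blast
  then show ?thesis by simp
qed

lemma convex_subgroup_convex:
  "convex_subgroup D \<Longrightarrow> x \<in> D \<Longrightarrow> 0 \<le> y \<Longrightarrow> y \<le> x \<Longrightarrow> y \<in> D"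
  unfolding convex_subgroup_def by blast

lemma (in abelian_monoid) finsum_swap:
  assumes "finite A" "finite B" "\<And>a b. a \<in> A \<Longrightarrow> b \<in> B \<Longrightarrow> F a b \<in> carrier G"
  shows "(\<Oplus>a\<in>A. \<Oplus>b\<in>B. F a b) = (\<Oplus>b\<in>B. \<Oplus>a\<in>A. F a b)"
  using assms(1,3)
proof (induction A rule: finite_induct)
  case empty
  then show ?case by simp
next
  case (insert x A)
  have "(\<Oplus>a\<in>insert x A. \<Oplus>b\<in>B. F a b) = (\<Oplus>b\<in>B. F x b) \<oplus> (\<Oplus>a\<in>A. \<Oplus>b\<in>B. F a b)"
    using insert by (intro finsum_insert) (auto intro!: finsum_closed)
  also have "\<dots> = (\<Oplus>b\<in>B. F x b) \<oplus> (\<Oplus>b\<in>B. \<Oplus>a\<in>A. F a b)"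
    using insert by simp
  also have "\<dots> = (\<Oplus>b\<in>B. F x b \<oplus> (\<Oplus>a\<in>A. F a b))"
    using insert by (intro finsum_addf[symmetric]) (auto intro!: finsum_closed)
  also have "\<dots> = (\<Oplus>b\<in>B. \<Oplus>a\<in>insert x A. F a b)"
    using insert by (intro finsum_cong') (auto intro!: finsum_closed finsum_insert[symmetric])
  finally show ?case .
qed

context ring
begin

definition supp :: "('g \<Rightarrow> 'a) \<Rightarrow> 'g set" where
  "supp f = {g. f g \<noteq> \<zero>}"

definition hahn :: "('g::linordered_ab_group_add \<Rightarrow> 'a) ring" where
  "hahn =
     \<lparr> carrier = {f. range f \<subseteq> carrier R \<and> wfp_on (supp f) (<)},
       monoid.mult = (\<lambda>f h g. \<Oplus>a\<in>{a \<in> supp f. g - a \<in> supp h}. f a \<otimes> h (g - a)),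
       monoid.one = (\<lambda>g. if g = 0 then \<one> else \<zero>),
       ring.zero = (\<lambda>g. \<zero>),
       ring.add = (\<lambda>f h g. f g \<oplus> h g) \<rparr>"

lemma in_supp_iff: "g \<in> supp f \<longleftrightarrow> f g \<noteq> \<zero>"
  by (simp add: supp_def)

lemma carrier_hahn_iff: "f \<in> carrier hahn \<longleftrightarrow> range f \<subseteq> carrier R \<and> wfp_on (supp f) (<)"
  by (simp add: hahn_def)

lemma hahn_coeff_closed [simp]: "f \<in> carrier hahn \<Longrightarrow> f g \<in> carrier R"
  by (auto simp: carrier_hahn_iff)

lemma wfp_on_supp: "f \<in> carrier hahn \<Longrightarrow> wfp_on (supp f) (<)"
  by (simp add: carrier_hahn_iff)

lemma hahn_one: "\<one>\<^bsub>hahn\<^esub> = (\<lambda>g. if g = 0 then \<one> else \<zero>)"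
  and hahn_zero: "\<zero>\<^bsub>hahn\<^esub> = (\<lambda>g. \<zero>)"
  and hahn_add: "f \<oplus>\<^bsub>hahn\<^esub> h = (\<lambda>g. f g \<oplus> h g)"
  by (simp_all add: hahn_def)

lemma hahn_mult_eq_finsum:
  assumes f: "f \<in> carrier hahn" and h: "h \<in> carrier hahn"
    and A: "finite A" "{a \<in> supp f. g - a \<in> supp h} \<subseteq> A"
  shows "(f \<otimes>\<^bsub>hahn\<^esub> h) g = (\<Oplus>a\<in>A. f a \<otimes> h (g - a))"
proof -
  have "(f \<otimes>\<^bsub>hahn\<^esub> h) g = (\<Oplus>a\<in>{a \<in> supp f. g - a \<in> supp h}. f a \<otimes> h (g - a))"
    by (simp add: hahn_def)
  also have "\<dots> = (\<Oplus>a\<in>A. f a \<otimes> h (g - a))"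
    by (rule add.finprod_mono_neutral_cong_left) (use f h A in \<open>auto simp: in_supp_iff\<close>)
  finally show ?thesis .
qed

lemma finite_hahn_fibre:
  "f \<in> carrier hahn \<Longrightarrow> h \<in> carrier hahn \<Longrightarrow> finite {a \<in> supp f. g - a \<in> supp h}"
  by (intro finite_fibre_of_sums wfp_on_supp)

lemma supp_hahn_mult: "supp (f \<otimes>\<^bsub>hahn\<^esub> h) \<subseteq> {a + b | a b. a \<in> supp f \<and> b \<in> supp h}"
proof
  fix g assume "g \<in> supp (f \<otimes>\<^bsub>hahn\<^esub> h)"
  then have "{a \<in> supp f. g - a \<in> supp h} \<noteq> {}"
    by (intro notI) (simp add: in_supp_iff[of g] hahn_def)
  then obtain a where "a \<in> supp f" "g - a \<in> supp h" by blast
  then show "g \<in> {a + b | a b. a \<in> supp f \<and> b \<in> supp h}"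
    unfolding mem_Collect_eq by (intro exI[of _ a] exI[of _ "g - a"]) simp
qed

lemma supp_hahn_mult_atLeast:
  assumes "supp f \<subseteq> {\<alpha>..}" "supp h \<subseteq> {\<beta>..}"
  shows "supp (f \<otimes>\<^bsub>hahn\<^esub> h) \<subseteq> {\<alpha> + \<beta>..}"
  using supp_hahn_mult[of f h] assms by (force intro: add_mono)

lemma hahn_mult_closed:
  assumes f: "f \<in> carrier hahn" and h: "h \<in> carrier hahn"
  shows "f \<otimes>\<^bsub>hahn\<^esub> h \<in> carrier hahn"
proof -
  have "(f \<otimes>\<^bsub>hahn\<^esub> h) g \<in> carrier R" for g
    unfolding hahn_mult_eq_finsum[OF f h finite_hahn_fibre[OF f h] order_refl]
    using f h by (intro finsum_closed) auto
  moreover have "wfp_on (supp (f \<otimes>\<^bsub>hahn\<^esub> h)) (<)"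
    by (intro wfp_on_subset[OF _ supp_hahn_mult] wfp_on_less_sums wfp_on_supp f h)
  ultimately show ?thesis by (auto simp: carrier_hahn_iff)
qed

lemma hahn_add_closed:
  assumes f: "f \<in> carrier hahn" and h: "h \<in> carrier hahn"
  shows "f \<oplus>\<^bsub>hahn\<^esub> h \<in> carrier hahn"
proof -
  have "supp (f \<oplus>\<^bsub>hahn\<^esub> h) \<subseteq> supp f \<union> supp h" by (auto simp: in_supp_iff hahn_add)
  then have "wfp_on (supp (f \<oplus>\<^bsub>hahn\<^esub> h)) (<)"
    by (rule wfp_on_subset[rotated]) (intro wfp_on_less_Un wfp_on_supp f h)
  then show ?thesis using f h by (auto simp: carrier_hahn_iff hahn_add)
qed

lemma hahn_uminus_closed: "h \<in> carrier hahn \<Longrightarrow> (\<lambda>g. \<ominus> h g) \<in> carrier hahn"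
  by (auto simp: carrier_hahn_iff in_supp_iff elim!: wfp_on_subset)

lemma hahn_finite_supp:
  "range f \<subseteq> carrier R \<Longrightarrow> finite (supp f) \<Longrightarrow> f \<in> carrier hahn"
  by (simp add: carrier_hahn_iff wfp_on_less_finite)

lemma hahn_zero_closed: "\<zero>\<^bsub>hahn\<^esub> \<in> carrier hahn"
  by (rule hahn_finite_supp) (auto simp: hahn_zero supp_def)

definition truncate :: "'g set \<Rightarrow> ('g \<Rightarrow> 'a) \<Rightarrow> 'g \<Rightarrow> 'a" where
  "truncate D f = (\<lambda>g. if g \<in> D then f g else \<zero>)"

lemma supp_truncate: "supp (truncate D f) = supp f \<inter> D"
  by (auto simp: supp_def truncate_def)

lemma truncate_closed: "f \<in> carrier hahn \<Longrightarrow> truncate D f \<in> carrier hahn"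
  using wfp_on_subset[of "supp f" "(<)" "supp f \<inter> D"]
  by (auto simp: carrier_hahn_iff supp_truncate) (auto simp: truncate_def)

definition hahn_monom :: "'a \<Rightarrow> 'g \<Rightarrow> 'g::linordered_ab_group_add \<Rightarrow> 'a" where
  "hahn_monom c g = (\<lambda>x. if x = g then c else \<zero>)"

lemma hahn_monom_closed: "c \<in> carrier R \<Longrightarrow> hahn_monom c g \<in> carrier hahn"
  by (rule hahn_finite_supp) (auto simp: hahn_monom_def supp_def)

lemma hahn_one_eq_monom: "\<one>\<^bsub>hahn\<^esub> = hahn_monom \<one> 0"
  by (simp add: hahn_one hahn_monom_def)

lemma hahn_monom_mult:
  assumes "c \<in> carrier R" "f \<in> carrier hahn"
  shows "(hahn_monom c g \<otimes>\<^bsub>hahn\<^esub> f) x = c \<otimes> f (x - g)"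
proof -
  have "(hahn_monom c g \<otimes>\<^bsub>hahn\<^esub> f) x = (\<Oplus>a\<in>{g}. hahn_monom c g a \<otimes> f (x - a))"
    by (rule hahn_mult_eq_finsum)
      (use assms hahn_monom_closed in \<open>auto simp: hahn_monom_def in_supp_iff\<close>)
  then show ?thesis using assms by (simp add: hahn_monom_def)
qed

lemma hahn_mult_lowest_coeff:
  assumes f: "f \<in> carrier hahn" "supp f \<subseteq> {\<alpha>..}" and h: "h \<in> carrier hahn" "supp h \<subseteq> {\<beta>..}"
  shows "(f \<otimes>\<^bsub>hahn\<^esub> h) (\<alpha> + \<beta>) = f \<alpha> \<otimes> h \<beta>"
proof -
  have "a = \<alpha>" if "a \<in> supp f" "\<alpha> + \<beta> - a \<in> supp h" for a
  proof (rule antisym)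
    have "\<beta> \<le> \<alpha> + \<beta> - a" using that h(2) by auto
    then show "a \<le> \<alpha>" by (simp add: le_diff_eq)
    show "\<alpha> \<le> a" using that f(2) by auto
  qed
  then have "(f \<otimes>\<^bsub>hahn\<^esub> h) (\<alpha> + \<beta>) = (\<Oplus>a\<in>{\<alpha>}. f a \<otimes> h (\<alpha> + \<beta> - a))"
    by (intro hahn_mult_eq_finsum f h) auto
  then show ?thesis using f h by simp
qed

end

context cring
begin

lemma hahn_mult_comm:
  assumes f: "f \<in> carrier hahn" and h: "h \<in> carrier hahn"
  shows "f \<otimes>\<^bsub>hahn\<^esub> h = h \<otimes>\<^bsub>hahn\<^esub> f"
proof
  fix g
  let ?A = "{a \<in> supp f. g - a \<in> supp h}" and ?B = "{b \<in> supp h. g - b \<in> supp f}"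
  have "(\<lambda>a. g - a) ` ?A = ?B"
  proof (intro equalityI subsetI)
    fix b assume "b \<in> ?B"
    then show "b \<in> (\<lambda>a. g - a) ` ?A" by (intro image_eqI[of _ _ "g - b"]) auto
  qed auto
  then have "(h \<otimes>\<^bsub>hahn\<^esub> f) g = (\<Oplus>b\<in>(\<lambda>a. g - a) ` ?A. h b \<otimes> f (g - b))"
    using hahn_mult_eq_finsum[OF h f finite_hahn_fibre[OF h f] order_refl, of g] by simp
  also have "\<dots> = (\<Oplus>a\<in>?A. h (g - a) \<otimes> f (g - (g - a)))"
    by (rule finsum_reindex) (use f h in \<open>auto simp: inj_on_def\<close>)
  also have "\<dots> = (\<Oplus>a\<in>?A. f a \<otimes> h (g - a))"
    by (rule finsum_cong') (use f h m_comm in auto)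
  also have "\<dots> = (f \<otimes>\<^bsub>hahn\<^esub> h) g"
    by (rule hahn_mult_eq_finsum[symmetric]) (use f h finite_hahn_fibre in auto)
  finally show "(f \<otimes>\<^bsub>hahn\<^esub> h) g = (h \<otimes>\<^bsub>hahn\<^esub> f) g" ..
qed

lemma hahn_mult_mult_eq_finsum:
  assumes f: "f \<in> carrier hahn" and h: "h \<in> carrier hahn" and k: "k \<in> carrier hahn"
    and A: "finite A" and C: "finite C" "C \<subseteq> supp k"
    and cover: "\<And>a c. a \<in> supp f \<Longrightarrow> c \<in> supp k \<Longrightarrow> g - c - a \<in> supp h \<Longrightarrow> a \<in> A \<and> c \<in> C"
  shows "(k \<otimes>\<^bsub>hahn\<^esub> (f \<otimes>\<^bsub>hahn\<^esub> h)) g = (\<Oplus>c\<in>C. \<Oplus>a\<in>A. k c \<otimes> (f a \<otimes> h (g - c - a)))"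
proof -
  note [simp] = f h k
  have "c \<in> C" if c: "c \<in> supp k" "g - c \<in> supp (f \<otimes>\<^bsub>hahn\<^esub> h)" for c
  proof -
    obtain a b where "g - c = a + b" "a \<in> supp f" "b \<in> supp h" using c(2) supp_hahn_mult by blast
    then show ?thesis using cover[of a c] c(1) by simp
  qed
  then have "(k \<otimes>\<^bsub>hahn\<^esub> (f \<otimes>\<^bsub>hahn\<^esub> h)) g = (\<Oplus>c\<in>C. k c \<otimes> (f \<otimes>\<^bsub>hahn\<^esub> h) (g - c))"
    using C(1) by (intro hahn_mult_eq_finsum) (auto intro: hahn_mult_closed)
  also have "\<dots> = (\<Oplus>c\<in>C. \<Oplus>a\<in>A. k c \<otimes> (f a \<otimes> h (g - c - a)))"
  proof (rule finsum_cong')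
    fix c assume "c \<in> C"
    then have "(f \<otimes>\<^bsub>hahn\<^esub> h) (g - c) = (\<Oplus>a\<in>A. f a \<otimes> h (g - c - a))"
      using A C(2) cover by (intro hahn_mult_eq_finsum) auto
    then show "k c \<otimes> (f \<otimes>\<^bsub>hahn\<^esub> h) (g - c) = (\<Oplus>a\<in>A. k c \<otimes> (f a \<otimes> h (g - c - a)))"
      using A by (simp add: finsum_rdistr)
  qed (auto intro!: finsum_closed)
  finally show ?thesis .
qed

lemma hahn_mult_lcomm:
  fixes f h k :: "'g::linordered_ab_group_add \<Rightarrow> 'a"
  assumes f: "f \<in> carrier hahn" and h: "h \<in> carrier hahn" and k: "k \<in> carrier hahn"
  shows "k \<otimes>\<^bsub>hahn\<^esub> (f \<otimes>\<^bsub>hahn\<^esub> h) = f \<otimes>\<^bsub>hahn\<^esub> (k \<otimes>\<^bsub>hahn\<^esub> h)"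
proof
  fix g
  note [simp] = f h k
  define A where "A = {a \<in> supp f. g - a \<in> {c + b | c b. c \<in> supp k \<and> b \<in> supp h}}"
  define C where "C = {c \<in> supp k. g - c \<in> {a + b | a b. a \<in> supp f \<and> b \<in> supp h}}"
  have fin: "finite A" "finite C"
    unfolding A_def C_def by (intro finite_fibre_of_sums wfp_on_less_sums wfp_on_supp f h k)+
  have cover: "a \<in> A \<and> c \<in> C" if "a \<in> supp f" "c \<in> supp k" "g - c - a \<in> supp h" for a c
  proof -
    have "g - a = c + (g - c - a)" "g - c = a + (g - c - a)" by simp_all
    then show ?thesis using that unfolding A_def C_def by blast
  qed
  have swap: "g - a - c = g - c - a" for a c :: 'g by (simp add: algebra_simps)
  have "(k \<otimes>\<^bsub>hahn\<^esub> (f \<otimes>\<^bsub>hahn\<^esub> h)) g = (\<Oplus>c\<in>C. \<Oplus>a\<in>A. k c \<otimes> (f a \<otimes> h (g - c - a)))"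
    using cover by (intro hahn_mult_mult_eq_finsum f h k fin) (auto simp: C_def)
  also have "\<dots> = (\<Oplus>a\<in>A. \<Oplus>c\<in>C. k c \<otimes> (f a \<otimes> h (g - c - a)))"
    by (intro finsum_swap fin) auto
  also have "\<dots> = (\<Oplus>a\<in>A. \<Oplus>c\<in>C. f a \<otimes> (k c \<otimes> h (g - a - c)))"
    by (intro finsum_cong' refl) (auto simp: swap m_lcomm intro!: finsum_closed)
  also have "\<dots> = (f \<otimes>\<^bsub>hahn\<^esub> (k \<otimes>\<^bsub>hahn\<^esub> h)) g"
    using cover swap by (intro hahn_mult_mult_eq_finsum[symmetric] f h k fin) (auto simp: A_def)
  finally show "(k \<otimes>\<^bsub>hahn\<^esub> (f \<otimes>\<^bsub>hahn\<^esub> h)) g = (f \<otimes>\<^bsub>hahn\<^esub> (k \<otimes>\<^bsub>hahn\<^esub> h)) g" .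
qed

lemma hahn_distrib:
  assumes f: "f \<in> carrier hahn" and h: "h \<in> carrier hahn" and k: "k \<in> carrier hahn"
  shows "(f \<oplus>\<^bsub>hahn\<^esub> h) \<otimes>\<^bsub>hahn\<^esub> k = f \<otimes>\<^bsub>hahn\<^esub> k \<oplus>\<^bsub>hahn\<^esub> h \<otimes>\<^bsub>hahn\<^esub> k"
proof
  fix g
  note [simp] = f h k
  define A where "A = {a \<in> supp f. g - a \<in> supp k} \<union> {a \<in> supp h. g - a \<in> supp k}"
  have A: "finite A" unfolding A_def by (intro finite_UnI finite_hahn_fibre f h k)
  have "{a \<in> supp (f \<oplus>\<^bsub>hahn\<^esub> h). g - a \<in> supp k} \<subseteq> A"
    by (auto simp: A_def in_supp_iff hahn_add)
  then have "((f \<oplus>\<^bsub>hahn\<^esub> h) \<otimes>\<^bsub>hahn\<^esub> k) g = (\<Oplus>a\<in>A. (f \<oplus>\<^bsub>hahn\<^esub> h) a \<otimes> k (g - a))"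
    by (rule hahn_mult_eq_finsum[OF hahn_add_closed[OF f h] k A])
  also have "\<dots> = (\<Oplus>a\<in>A. f a \<otimes> k (g - a)) \<oplus> (\<Oplus>a\<in>A. h a \<otimes> k (g - a))"
    by (simp add: hahn_add l_distr finsum_addf)
  also have "\<dots> = (f \<otimes>\<^bsub>hahn\<^esub> k) g \<oplus> (h \<otimes>\<^bsub>hahn\<^esub> k) g"
    using hahn_mult_eq_finsum[OF f k A] hahn_mult_eq_finsum[OF h k A] by (simp add: A_def)
  finally show "((f \<oplus>\<^bsub>hahn\<^esub> h) \<otimes>\<^bsub>hahn\<^esub> k) g = (f \<otimes>\<^bsub>hahn\<^esub> k \<oplus>\<^bsub>hahn\<^esub> h \<otimes>\<^bsub>hahn\<^esub> k) g"
    by (simp add: hahn_add)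
qed

lemma hahn_cring: "cring (hahn :: ('g::linordered_ab_group_add \<Rightarrow> 'a) ring)"
proof (rule cringI)
  show "abelian_group (hahn :: ('g \<Rightarrow> 'a) ring)"
  proof (rule abelian_groupI)
    fix f :: "'g \<Rightarrow> 'a" assume f: "f \<in> carrier hahn"
    have "(\<lambda>g. \<ominus> f g) \<oplus>\<^bsub>hahn\<^esub> f = \<zero>\<^bsub>hahn\<^esub>" using f by (simp add: hahn_add hahn_zero l_neg)
    then show "\<exists>h\<in>carrier hahn. h \<oplus>\<^bsub>hahn\<^esub> f = \<zero>\<^bsub>hahn\<^esub>" using hahn_uminus_closed[OF f] by blast
  next
    show "\<zero>\<^bsub>hahn\<^esub> \<in> carrier (hahn :: ('g \<Rightarrow> 'a) ring)" by (rule hahn_zero_closed)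
  qed (erule (1) hahn_add_closed | simp add: hahn_add hahn_zero a_ac)+
  show "comm_monoid (hahn :: ('g \<Rightarrow> 'a) ring)"
  proof (rule comm_monoidI)
    fix f h k :: "'g \<Rightarrow> 'a"
    assume f: "f \<in> carrier hahn" and h: "h \<in> carrier hahn" and k: "k \<in> carrier hahn"
    have "(f \<otimes>\<^bsub>hahn\<^esub> h) \<otimes>\<^bsub>hahn\<^esub> k = k \<otimes>\<^bsub>hahn\<^esub> (f \<otimes>\<^bsub>hahn\<^esub> h)"
      by (intro hahn_mult_comm hahn_mult_closed f h k)
    also have "\<dots> = f \<otimes>\<^bsub>hahn\<^esub> (k \<otimes>\<^bsub>hahn\<^esub> h)" by (intro hahn_mult_lcomm f h k)
    also have "k \<otimes>\<^bsub>hahn\<^esub> h = h \<otimes>\<^bsub>hahn\<^esub> k" by (intro hahn_mult_comm h k)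
    finally show "(f \<otimes>\<^bsub>hahn\<^esub> h) \<otimes>\<^bsub>hahn\<^esub> k = f \<otimes>\<^bsub>hahn\<^esub> (h \<otimes>\<^bsub>hahn\<^esub> k)" .
  qed (auto simp: hahn_mult_closed hahn_one_eq_monom hahn_monom_closed hahn_monom_mult
      intro: hahn_mult_comm)
qed (rule hahn_distrib)

lemma hahn_uminus:
  fixes h :: "'g::linordered_ab_group_add \<Rightarrow> 'a"
  assumes h: "h \<in> carrier hahn"
  shows "\<ominus>\<^bsub>hahn\<^esub> h = (\<lambda>g. \<ominus> h g)"
proof -
  interpret H: cring "hahn :: ('g \<Rightarrow> 'a) ring" by (rule hahn_cring)
  have "(\<lambda>g. \<ominus> h g) \<oplus>\<^bsub>hahn\<^esub> h = \<zero>\<^bsub>hahn\<^esub>" using h by (simp add: hahn_add hahn_zero l_neg)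
  then show ?thesis using h hahn_uminus_closed by (intro H.minus_equality)
qed

lemma hahn_minus:
  "f \<in> carrier hahn \<Longrightarrow> h \<in> carrier hahn \<Longrightarrow> (f \<ominus>\<^bsub>hahn\<^esub> h) g = f g \<ominus> h g"
  by (simp add: a_minus_def hahn_uminus hahn_add)

lemma truncate_hahn_mult:
  fixes f h :: "'g::linordered_ab_group_add \<Rightarrow> 'a"
  assumes D: "convex_subgroup D" and f: "f \<in> carrier hahn" "supp f \<subseteq> {0..}"
    and h: "h \<in> carrier hahn" "supp h \<subseteq> {0..}"
  shows "truncate D (f \<otimes>\<^bsub>hahn\<^esub> h) = truncate D f \<otimes>\<^bsub>hahn\<^esub> truncate D h"
proof
  fix g
  let ?A = "{a \<in> supp f. g - a \<in> supp h}"
  have fin: "finite ?A" by (intro finite_hahn_fibre f h)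
  have lhs: "(f \<otimes>\<^bsub>hahn\<^esub> h) g = (\<Oplus>a\<in>?A. f a \<otimes> h (g - a))"
    by (intro hahn_mult_eq_finsum f h fin order_refl)
  have rhs: "(truncate D f \<otimes>\<^bsub>hahn\<^esub> truncate D h) g = (\<Oplus>a\<in>?A. truncate D f a \<otimes> truncate D h (g - a))"
    by (rule hahn_mult_eq_finsum)
      (use fin f(1) h(1) in \<open>auto simp: truncate_closed supp_truncate\<close>)
  show "truncate D (f \<otimes>\<^bsub>hahn\<^esub> h) g = (truncate D f \<otimes>\<^bsub>hahn\<^esub> truncate D h) g"
  proof (cases "g \<in> D")
    case True
    have "a \<in> D \<and> g - a \<in> D" if "a \<in> ?A" for a
    proof -
      have "0 \<le> a" "0 \<le> g - a" using that f(2) h(2) by auto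
      then show ?thesis using convex_subgroup_convex[OF D True] by simp
    qed
    then have "(\<Oplus>a\<in>?A. truncate D f a \<otimes> truncate D h (g - a)) = (\<Oplus>a\<in>?A. f a \<otimes> h (g - a))"
      using f(1) h(1) by (intro finsum_cong') (auto simp: truncate_def)
    then show ?thesis using True by (simp add: lhs rhs truncate_def[of D "f \<otimes>\<^bsub>hahn\<^esub> h"])
  next
    case False
    have "truncate D f a \<otimes> truncate D h (g - a) = \<zero>" for a
      using convex_subgroup_add[OF D, of a "g - a"] False f(1) h(1) by (auto simp: truncate_def)
    then show ?thesis using False by (simp add: rhs truncate_def[of D "f \<otimes>\<^bsub>hahn\<^esub> h"])
  qed
qed

definition finite_series :: "('g::linordered_ab_group_add \<Rightarrow> 'a) set" where
  "finite_series = {f. range f \<subseteq> carrier R \<and> finite (supp f)}"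

lemma finite_series_subset: "finite_series \<subseteq> carrier hahn"
  by (auto simp: finite_series_def hahn_finite_supp)

lemma hahn_monom_finite: "c \<in> carrier R \<Longrightarrow> hahn_monom c g \<in> finite_series"
  by (auto simp: finite_series_def hahn_monom_def supp_def)

lemma finite_series_subring: "subring finite_series (hahn :: ('g::linordered_ab_group_add \<Rightarrow> 'a) ring)"
proof -
  interpret H: cring "hahn :: ('g \<Rightarrow> 'a) ring" by (rule hahn_cring)
  show ?thesis
  proof (rule H.subringI)
    show "finite_series \<subseteq> carrier hahn" by (rule finite_series_subset)
    show "\<one>\<^bsub>hahn\<^esub> \<in> finite_series" by (simp add: hahn_one_eq_monom hahn_monom_finite)
  next
    fix f h :: "'g \<Rightarrow> 'a" assume f: "f \<in> finite_series" and h: "h \<in> finite_series"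
    then have closed: "f \<in> carrier hahn" "h \<in> carrier hahn" using finite_series_subset by auto
    have fin: "finite (supp f)" "finite (supp h)" using f h by (auto simp: finite_series_def)
    have "supp (\<ominus>\<^bsub>hahn\<^esub> h) \<subseteq> supp h" using closed by (auto simp: hahn_uminus in_supp_iff)
    then have "finite (supp (\<ominus>\<^bsub>hahn\<^esub> h))" using fin(2) by (rule finite_subset)
    then show "\<ominus>\<^bsub>hahn\<^esub> h \<in> finite_series" using closed by (auto simp: finite_series_def)
    have "supp (f \<oplus>\<^bsub>hahn\<^esub> h) \<subseteq> supp f \<union> supp h" by (auto simp: hahn_add in_supp_iff)
    then have "finite (supp (f \<oplus>\<^bsub>hahn\<^esub> h))" by (rule finite_subset) (simp add: fin)
    then show "f \<oplus>\<^bsub>hahn\<^esub> h \<in> finite_series" using closed by (auto simp: finite_series_def)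
    have "supp (f \<otimes>\<^bsub>hahn\<^esub> h) \<subseteq> {a + b | a b. a \<in> supp f \<and> b \<in> supp h}" by (rule supp_hahn_mult)
    then have "finite (supp (f \<otimes>\<^bsub>hahn\<^esub> h))" by (rule finite_subset) (simp add: fin finite_image_set2)
    then show "f \<otimes>\<^bsub>hahn\<^esub> h \<in> finite_series" using closed by (auto simp: finite_series_def)
  qed
qed

lemma card_of_finite_series_ordLeq:
  assumes "Cinfinite r" "|UNIV :: 'g::linordered_ab_group_add set| \<le>o r" "|carrier R| \<le>o r"
  shows "|finite_series :: ('g \<Rightarrow> 'a) set| \<le>o r"
  by (rule card_of_subset_ordLeq[OF _ card_of_finite_support_ordLeq[OF assms]])
    (auto simp: finite_series_def supp_def)

end

context "domain"
begin

definition hahn_val :: "('g::linordered_ab_group_add \<Rightarrow> 'a) \<Rightarrow> 'g" where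
  "hahn_val f = (LEAST g. g \<in> supp f)"

lemma hahn_val_eqI: "m \<in> supp f \<Longrightarrow> supp f \<subseteq> {m..} \<Longrightarrow> hahn_val f = m"
  unfolding hahn_val_def by (rule Least_equality) auto

lemma hahn_val:
  assumes "f \<in> carrier hahn" "f \<noteq> \<zero>\<^bsub>hahn\<^esub>"
  shows hahn_val_in_supp: "hahn_val f \<in> supp f" and supp_atLeast_hahn_val: "supp f \<subseteq> {hahn_val f..}"
proof -
  have "supp f \<noteq> {}" using assms(2) by (auto simp: hahn_zero supp_def fun_eq_iff)
  then obtain m where m: "m \<in> supp f" "\<And>g. g \<in> supp f \<Longrightarrow> m \<le> g"
    using wfp_on_less_least[OF wfp_on_supp[OF assms(1)] order_refl] by metis
  then have "hahn_val f = m" by (intro hahn_val_eqI) auto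
  then show "hahn_val f \<in> supp f" "supp f \<subseteq> {hahn_val f..}" using m by auto
qed

lemma hahn_val_ge_iff:
  assumes "f \<in> carrier hahn" "f \<noteq> \<zero>\<^bsub>hahn\<^esub>"
  shows "g \<le> hahn_val f \<longleftrightarrow> supp f \<subseteq> {g..}"
  using hahn_val[OF assms] by auto

lemma hahn_val_monom: "c \<noteq> \<zero> \<Longrightarrow> hahn_val (hahn_monom c g) = g"
  by (rule hahn_val_eqI) (auto simp: hahn_monom_def in_supp_iff split: if_splits)

lemma hahn_monom_nonzero: "c \<noteq> \<zero> \<Longrightarrow> hahn_monom c g \<noteq> \<zero>\<^bsub>hahn\<^esub>"
  by (auto simp: hahn_monom_def hahn_zero dest: fun_cong[where x = g])

lemma hahn_val_mult:
  assumes f: "f \<in> carrier hahn" "f \<noteq> \<zero>\<^bsub>hahn\<^esub>" and h: "h \<in> carrier hahn" "h \<noteq> \<zero>\<^bsub>hahn\<^esub>"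
  shows "hahn_val (f \<otimes>\<^bsub>hahn\<^esub> h) = hahn_val f + hahn_val h"
proof (rule hahn_val_eqI)
  note supp = supp_atLeast_hahn_val[OF f] supp_atLeast_hahn_val[OF h]
  show "supp (f \<otimes>\<^bsub>hahn\<^esub> h) \<subseteq> {hahn_val f + hahn_val h..}" by (rule supp_hahn_mult_atLeast[OF supp])
  have "(f \<otimes>\<^bsub>hahn\<^esub> h) (hahn_val f + hahn_val h) = f (hahn_val f) \<otimes> h (hahn_val h)"
    by (rule hahn_mult_lowest_coeff[OF f(1) supp(1) h(1) supp(2)])
  then show "hahn_val f + hahn_val h \<in> supp (f \<otimes>\<^bsub>hahn\<^esub> h)"
    using hahn_val_in_supp[OF f] hahn_val_in_supp[OF h] f(1) h(1)
    by (simp add: in_supp_iff integral_iff)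
qed

lemma hahn_val_add:
  assumes f: "f \<in> carrier hahn" "f \<noteq> \<zero>\<^bsub>hahn\<^esub>" and h: "h \<in> carrier hahn" "h \<noteq> \<zero>\<^bsub>hahn\<^esub>"
    and sum: "f \<oplus>\<^bsub>hahn\<^esub> h \<noteq> \<zero>\<^bsub>hahn\<^esub>"
  shows "min (hahn_val f) (hahn_val h) \<le> hahn_val (f \<oplus>\<^bsub>hahn\<^esub> h)"
proof -
  have "supp (f \<oplus>\<^bsub>hahn\<^esub> h) \<subseteq> supp f \<union> supp h" by (auto simp: hahn_add in_supp_iff)
  also have "\<dots> \<subseteq> {min (hahn_val f) (hahn_val h)..}"
    using supp_atLeast_hahn_val[OF f] supp_atLeast_hahn_val[OF h] by (auto simp: min_le_iff_disj)
  finally show ?thesis using hahn_val_ge_iff[OF hahn_add_closed[OF f(1) h(1)] sum] by blast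
qed

end

context field
begin

lemma ex_recursive_hahn_series:
  fixes u c :: "'g::linordered_ab_group_add \<Rightarrow> 'a"
  assumes W: "wfp_on W (<)" and pos: "\<And>a. a \<in> S \<Longrightarrow> 0 < a"
    and u: "\<And>g. u g \<in> carrier R" and c: "\<And>g. c g \<in> carrier R"
  obtains h where "h \<in> carrier hahn" "supp h \<subseteq> W"
    "\<forall>g\<in>W. h g \<oplus> (\<Oplus>a\<in>{a \<in> S. g - a \<in> W}. u a \<otimes> h (g - a)) = c g"
proof -
  let ?sum = "\<lambda>k g. \<Oplus>a\<in>{a \<in> S. g - a \<in> W}. u a \<otimes> k (g - a)"
  obtain k where k: "\<And>g. g \<in> W \<Longrightarrow> k g \<in> carrier R" "\<And>g. g \<in> W \<Longrightarrow> k g = c g \<ominus> ?sum k g"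
  proof (rule wfp_on_less_recursion[OF W, of "carrier R" "\<lambda>k g. c g \<ominus> ?sum k g"])
    fix k :: "'g \<Rightarrow> 'a" and g :: 'g assume "\<And>x. x \<in> W \<Longrightarrow> x < g \<Longrightarrow> k x \<in> carrier R"
    then show "c g \<ominus> ?sum k g \<in> carrier R"
      using pos u c by (intro minus_closed finsum_closed) auto
  next
    fix k k' :: "'g \<Rightarrow> 'a" and g :: 'g
    assume eq: "\<And>x. x \<in> W \<Longrightarrow> x < g \<Longrightarrow> k x \<in> carrier R \<and> k x = k' x"
    have "k (g - a) = k' (g - a)" "k' (g - a) \<in> carrier R" if "a \<in> S" "g - a \<in> W" for a
      using eq[of "g - a"] pos that by auto
    then have "?sum k g = ?sum k' g" using u by (intro finsum_cong') auto
    then show "c g \<ominus> ?sum k g = c g \<ominus> ?sum k' g" by simp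
  qed (rule that)
  let ?h = "truncate W k"
  have supp: "supp ?h \<subseteq> W" unfolding supp_truncate by simp
  then have "?h \<in> carrier hahn"
    using k(1) wfp_on_subset[OF W supp] by (auto simp: carrier_hahn_iff truncate_def)
  moreover have "?h g \<oplus> ?sum ?h g = c g" if g: "g \<in> W" for g
  proof -
    have "?sum ?h g = ?sum k g" using u k(1) by (intro finsum_cong') (auto simp: truncate_def)
    moreover have "?sum k g \<in> carrier R" using u k(1) by (intro finsum_closed) auto
    ultimately show ?thesis using c k(2)[OF g] g by (simp add: truncate_def minus_eq a_assoc l_neg)
  qed
  ultimately show thesis using that supp by blast
qed

lemma hahn_right_inverse_of_one_plus:
  fixes u :: "'g::linordered_ab_group_add \<Rightarrow> 'a"
  assumes u: "u \<in> carrier hahn" "supp u \<subseteq> {0..}" "u 0 = \<one>"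
  obtains h where "h \<in> carrier hahn" "u \<otimes>\<^bsub>hahn\<^esub> h = \<one>\<^bsub>hahn\<^esub>"
proof -
  define S where "S = supp u - {0}"
  define W where "W = sum_list ` lists S"
  let ?A = "\<lambda>g. {a \<in> S. g - a \<in> W}"
  have S: "wfp_on S (<)" using wfp_on_supp[OF u(1)] by (rule wfp_on_subset) (auto simp: S_def)
  have S_pos: "0 < a" if "a \<in> S" for a using that u(2) by (auto simp: S_def)
  have W: "wfp_on W (<)" unfolding W_def by (rule wfp_on_less_sum_lists[OF S S_pos])
  have zero_W: "0 \<in> W" unfolding W_def by (rule image_eqI[of _ _ "[]"]) auto
  have S_add_W: "g \<in> W" if "a \<in> S" "g - a \<in> W" for a g
    using add_mem_sum_lists[of a S "g - a"] that unfolding W_def by simp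
  have one_coeff_closed: "\<one>\<^bsub>hahn\<^esub> g \<in> carrier R" for g :: 'g by (simp add: hahn_one)
  obtain h where h: "h \<in> carrier hahn" and supp_h: "supp h \<subseteq> W"
    and recursion: "\<forall>g\<in>W. h g \<oplus> (\<Oplus>a\<in>?A g. u a \<otimes> h (g - a)) = \<one>\<^bsub>hahn\<^esub> g"
    by (rule ex_recursive_hahn_series[OF W S_pos hahn_coeff_closed[OF u(1)] one_coeff_closed])
  have "(u \<otimes>\<^bsub>hahn\<^esub> h) g = \<one>\<^bsub>hahn\<^esub> g" for g
  proof (cases "g \<in> W")
    case True
    have fin: "finite (?A g)" by (rule finite_fibre_of_sums[OF S W])
    have "{a \<in> supp u. g - a \<in> supp h} \<subseteq> insert 0 (?A g)" using supp_h by (auto simp: S_def)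
    then have "(u \<otimes>\<^bsub>hahn\<^esub> h) g = (\<Oplus>a\<in>insert 0 (?A g). u a \<otimes> h (g - a))"
      using fin by (intro hahn_mult_eq_finsum u h) auto
    also have "\<dots> = u 0 \<otimes> h g \<oplus> (\<Oplus>a\<in>?A g. u a \<otimes> h (g - a))"
      using fin u(1) h by (subst finsum_insert) (auto simp: S_def)
    finally show ?thesis using recursion True u(3) h by simp
  next
    case False
    then have "{a \<in> supp u. g - a \<in> supp h} = {}" using supp_h S_add_W by (force simp: S_def)
    then have "(u \<otimes>\<^bsub>hahn\<^esub> h) g = (\<Oplus>a\<in>{}. u a \<otimes> h (g - a))"
      by (intro hahn_mult_eq_finsum u h) auto
    moreover have "g \<noteq> 0" using False zero_W by auto
    ultimately show ?thesis by (simp add: hahn_one)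
  qed
  then show thesis using that h by blast
qed

lemma hahn_field: "field (hahn :: ('g::linordered_ab_group_add \<Rightarrow> 'a) ring)"
proof -
  interpret H: cring "hahn :: ('g \<Rightarrow> 'a) ring" by (rule hahn_cring)
  show ?thesis
  proof (rule H.cring_fieldI2)
    show "\<zero>\<^bsub>hahn\<^esub> \<noteq> (\<one>\<^bsub>hahn\<^esub> :: 'g \<Rightarrow> 'a)"
      using hahn_monom_nonzero[OF one_not_zero] unfolding hahn_one_eq_monom by metis
    fix f :: "'g \<Rightarrow> 'a" assume f: "f \<in> carrier hahn" "f \<noteq> \<zero>\<^bsub>hahn\<^esub>"
    define c where "c = f (hahn_val f)"
    have c: "c \<in> carrier R" "c \<noteq> \<zero>" using hahn_val_in_supp[OF f] f(1) by (auto simp: c_def in_supp_iff)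
    define M where "M = hahn_monom (inv c) (- hahn_val f)"
    define u where "u = M \<otimes>\<^bsub>hahn\<^esub> f"
    have M: "M \<in> carrier hahn" unfolding M_def by (intro hahn_monom_closed inv_of_nonzero c)
    have u: "u \<in> carrier hahn" unfolding u_def by (intro hahn_mult_closed M f)
    have u_coeff: "u x = inv c \<otimes> f (x + hahn_val f)" for x
      unfolding u_def M_def using hahn_monom_mult[of "inv c" f] inv_of_nonzero[OF c] f(1) by simp
    have "supp u \<subseteq> {0..}"
    proof
      fix x assume "x \<in> supp u"
      then have "x + hahn_val f \<in> supp f"
        using inv_of_nonzero[OF c] f(1) by (auto simp: in_supp_iff u_coeff)
      then have "hahn_val f \<le> x + hahn_val f" using supp_atLeast_hahn_val[OF f] by auto
      then show "x \<in> {0..}" by simp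
    qed
    moreover have "u 0 = \<one>" using inv_of_nonzero[OF c] by (simp add: u_coeff flip: c_def)
    ultimately obtain h where h: "h \<in> carrier hahn" "u \<otimes>\<^bsub>hahn\<^esub> h = \<one>\<^bsub>hahn\<^esub>"
      using hahn_right_inverse_of_one_plus[OF u] by metis
    have "f \<otimes>\<^bsub>hahn\<^esub> (M \<otimes>\<^bsub>hahn\<^esub> h) = u \<otimes>\<^bsub>hahn\<^esub> h"
      unfolding u_def using M f h by (simp add: H.m_ac)
    then show "\<exists>k\<in>carrier hahn. f \<otimes>\<^bsub>hahn\<^esub> k = \<one>\<^bsub>hahn\<^esub>"
      using h M by (intro bexI[of _ "M \<otimes>\<^bsub>hahn\<^esub> h"]) auto
  qed
qed

end

section \<open>Subfields of Hahn fields\<close>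

lemma (in cring) supp_minus_if_truncate_eq:
  assumes D: "convex_subgroup D" "g \<in> D" and f: "f \<in> carrier hahn" "supp f \<subseteq> {0..}"
    and h: "h \<in> carrier hahn" "supp h \<subseteq> {0..}" and eq: "truncate D f = truncate D h"
  shows "supp (f \<ominus>\<^bsub>hahn\<^esub> h) \<subseteq> {g..}"
proof
  fix x assume x: "x \<in> supp (f \<ominus>\<^bsub>hahn\<^esub> h)"
  then have "f x \<noteq> h x" using f(1) h(1) by (auto simp: in_supp_iff hahn_minus)
  then have "x \<notin> D" using fun_cong[OF eq, of x] by (auto simp: truncate_def)
  moreover have "x \<in> supp f \<union> supp h" using \<open>f x \<noteq> h x\<close> by (auto simp: in_supp_iff)
  then have "0 \<le> x" using f(2) h(2) by auto
  ultimately have "\<not> x \<le> g" using convex_subgroup_convex[OF D] by blast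
  then show "x \<in> {g..}" by simp
qed

definition (in ring) indicator_series :: "'g::linordered_ab_group_add set \<Rightarrow> 'g \<Rightarrow> 'a" where
  "indicator_series A = (\<lambda>g. if g \<in> A then \<one> else \<zero>)"

context "domain"
begin

lemma supp_indicator_series: "supp (indicator_series A) = A"
  by (auto simp: supp_def indicator_series_def)

lemma indicator_series_closed: "wfp_on A (<) \<Longrightarrow> indicator_series A \<in> carrier hahn"
  by (auto simp: carrier_hahn_iff supp_indicator_series) (auto simp: indicator_series_def)

lemma inj_indicator_series: "inj indicator_series"
  by (rule injI) (metis supp_indicator_series)

lemma hahn_val_indicator_series_minus:
  fixes A B :: "'g::linordered_ab_group_add set"
  assumes A: "wfp_on A (<)" and B: "wfp_on B (<)" and "A \<noteq> B"
  shows "hahn_val (indicator_series A \<ominus>\<^bsub>hahn\<^esub> indicator_series B) \<in> A \<union> B"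
proof -
  interpret H: cring "hahn :: ('g \<Rightarrow> 'a) ring" by (rule hahn_cring)
  let ?d = "indicator_series A \<ominus>\<^bsub>hahn\<^esub> indicator_series B"
  note closed = indicator_series_closed[OF A] indicator_series_closed[OF B]
  have "?d \<noteq> \<zero>\<^bsub>hahn\<^esub>" using closed \<open>A \<noteq> B\<close> by (simp add: inj_eq[OF inj_indicator_series])
  then have "hahn_val ?d \<in> supp ?d" using closed by (intro hahn_val_in_supp) auto
  also have "supp ?d \<subseteq> A \<union> B"
    using closed by (auto simp: supp_def hahn_minus) (auto simp: indicator_series_def split: if_splits)
  finally show ?thesis .
qed

end

context field
begin

lemma hahn_valued_field: "valued_field (hahn :: ('g::linordered_ab_group_add \<Rightarrow> 'a) ring) hahn_val"
  by (intro valued_field.intro valued_field_axioms.intro hahn_field hahn_val_mult hahn_val_add)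

lemma fractions_finite_seriesE:
  fixes x :: "'g::linordered_ab_group_add \<Rightarrow> 'a"
  assumes x: "x \<in> fractions hahn finite_series"
  obtains b where "b \<in> finite_series" "supp b \<subseteq> {0..}" "b 0 \<noteq> \<zero>" "x \<otimes>\<^bsub>hahn\<^esub> b \<in> finite_series"
proof -
  interpret H: valued_field "hahn :: ('g \<Rightarrow> 'a) ring" hahn_val by (rule hahn_valued_field)
  obtain b where b: "x \<in> carrier hahn" "b \<in> finite_series" "b \<noteq> \<zero>\<^bsub>hahn\<^esub>" "x \<otimes>\<^bsub>hahn\<^esub> b \<in> finite_series"
    using finite_series_subring x by (rule H.fractionsE)
  define M where "M = hahn_monom \<one> (- hahn_val b)"
  define b' where "b' = M \<otimes>\<^bsub>hahn\<^esub> b"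
  have M: "M \<in> finite_series" "M \<noteq> \<zero>\<^bsub>hahn\<^esub>" "hahn_val M = - hahn_val b"
    by (simp_all add: M_def hahn_monom_finite hahn_monom_nonzero hahn_val_monom)
  have closed: "M \<in> carrier hahn" "b \<in> carrier hahn" using M(1) b(2) finite_series_subset by auto
  have b': "b' \<in> finite_series" unfolding b'_def by (intro subringE(6)[OF finite_series_subring] M b)
  have b'_nonzero: "b' \<in> carrier hahn" "b' \<noteq> \<zero>\<^bsub>hahn\<^esub>"
    using closed M(2) b(3) by (auto simp: b'_def H.integral_iff)
  have "hahn_val b' = 0" unfolding b'_def using H.v_mult[of M b] closed M(2,3) b(3) by simp
  then have "supp b' \<subseteq> {0..}" "b' 0 \<noteq> \<zero>"
    using supp_atLeast_hahn_val[OF b'_nonzero] hahn_val_in_supp[OF b'_nonzero]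
    by (simp_all add: in_supp_iff)
  moreover have "x \<otimes>\<^bsub>hahn\<^esub> b' = M \<otimes>\<^bsub>hahn\<^esub> (x \<otimes>\<^bsub>hahn\<^esub> b)"
    unfolding b'_def using closed b(1) by (simp add: H.m_lcomm)
  then have "x \<otimes>\<^bsub>hahn\<^esub> b' \<in> finite_series"
    using subringE(6)[OF finite_series_subring M(1) b(4)] by simp
  ultimately show thesis using that b' by blast
qed

lemma countable_truncate_fractions_finite_series:
  fixes D :: "'g::linordered_ab_group_add set"
  assumes R: "countable (carrier R)" and D: "convex_subgroup D" "countable D"
  shows "countable (truncate D ` {x \<in> fractions hahn finite_series. supp x \<subseteq> {0..}})"
proof -
  interpret H: field "hahn :: ('g \<Rightarrow> 'a) ring" by (rule hahn_field)
  define T where "T = {f :: 'g \<Rightarrow> 'a. finite {x. f x \<noteq> \<zero>} \<and> (\<forall>x. f x \<noteq> \<zero> \<longrightarrow> x \<in> D \<and> f x \<in> carrier R)}"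
  have "countable T"
    using R D(2) unfolding T_def countable_card_le_natLeq
    by (intro card_of_finite_support_ordLeq[OF natLeq_Cinfinite])
  have truncate_T: "truncate D f \<in> T" if f: "f \<in> finite_series" for f
  proof -
    have "finite (supp (truncate D f))" using f by (simp add: supp_truncate finite_series_def)
    moreover have "x \<in> D \<and> truncate D f x \<in> carrier R" if "truncate D f x \<noteq> \<zero>" for x
      using f that by (auto simp: finite_series_def truncate_def split: if_splits)
    ultimately show ?thesis by (simp add: T_def supp_def)
  qed
  have "truncate D x \<in> (\<lambda>(a, b). a \<otimes>\<^bsub>hahn\<^esub> inv\<^bsub>hahn\<^esub> b) ` (T \<times> T)"
    if x: "x \<in> fractions hahn finite_series" "supp x \<subseteq> {0..}" for x
  proof -
    obtain b where b: "b \<in> finite_series" "supp b \<subseteq> {0..}" "b 0 \<noteq> \<zero>" "x \<otimes>\<^bsub>hahn\<^esub> b \<in> finite_series"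
      using x(1) by (rule fractions_finite_seriesE)
    have closed: "x \<in> carrier hahn" "b \<in> carrier hahn"
      using x(1) H.fractionsE[OF finite_series_subring] b(1) finite_series_subset by blast+
    have "0 \<in> D" using D(1) by (simp add: convex_subgroup_def)
    then have "truncate D b 0 \<noteq> \<zero>" using b(3) by (simp add: truncate_def)
    then have nonzero: "truncate D b \<noteq> \<zero>\<^bsub>hahn\<^esub>" by (auto simp: hahn_zero)
    have "truncate D x \<otimes>\<^bsub>hahn\<^esub> truncate D b = truncate D (x \<otimes>\<^bsub>hahn\<^esub> b)"
      using truncate_hahn_mult[OF D(1) closed(1) x(2) closed(2) b(2)] ..
    then have "truncate D x = truncate D (x \<otimes>\<^bsub>hahn\<^esub> b) \<otimes>\<^bsub>hahn\<^esub> inv\<^bsub>hahn\<^esub> truncate D b"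
      using H.eq_mult_inv_iff nonzero closed truncate_closed H.m_closed by metis
    then show ?thesis using truncate_T[OF b(1)] truncate_T[OF b(4)] by force
  qed
  then have "truncate D ` {x \<in> fractions hahn finite_series. supp x \<subseteq> {0..}} \<subseteq>
      (\<lambda>(a, b). a \<otimes>\<^bsub>hahn\<^esub> inv\<^bsub>hahn\<^esub> b) ` (T \<times> T)"
    by blast
  then show ?thesis
    by (rule countable_subset) (intro countable_image countable_SIGMA \<open>countable T\<close>)
qed

end

locale hahn_embedded_field = K: field K + field Q
  for K :: "('k, 'm) ring_scheme" and Q :: "('q, 'n) ring_scheme" (structure) +
  fixes e :: "'q \<Rightarrow> 'g::linordered_ab_group_add \<Rightarrow> 'k"
  assumes e_hom: "e \<in> ring_hom Q K.hahn"
    and monom_in_image: "c \<in> carrier K \<Longrightarrow> K.hahn_monom c g \<in> e ` carrier Q"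
begin

abbreviation val :: "'q \<Rightarrow> 'g" where "val \<equiv> K.hahn_val \<circ> e"

lemma e_closed: "x \<in> carrier Q \<Longrightarrow> e x \<in> carrier K.hahn"
  by (rule ring_hom_closed[OF e_hom])

lemma e_eq_zero_iff: "x \<in> carrier Q \<Longrightarrow> e x = \<zero>\<^bsub>K.hahn\<^esub> \<longleftrightarrow> x = \<zero>"
  by (rule field_hom_eq_zero_iff[OF field_axioms K.hahn_field e_hom])

lemma e_minus: "x \<in> carrier Q \<Longrightarrow> y \<in> carrier Q \<Longrightarrow> e (x \<ominus> y) = e x \<ominus>\<^bsub>K.hahn\<^esub> e y"
  by (rule ring_hom_cring.hom_sub[OF ring_hom_cring.intro[OF is_cring K.hahn_cring]])
    (simp_all add: ring_hom_cring_axioms_def e_hom)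

sublocale surj_valued_field Q val
proof (intro surj_valued_field.intro surj_valued_field_axioms.intro)
  show "valued_field Q val" by (rule valued_field_pullback[OF K.hahn_valued_field field_axioms e_hom])
  fix g
  obtain x where x: "x \<in> carrier Q" "e x = K.hahn_monom \<one>\<^bsub>K\<^esub> g"
    using monom_in_image[OF K.one_closed, of g] by (metis imageE)
  then have "x \<noteq> \<zero>" using K.hahn_monom_nonzero[OF K.one_not_zero] e_eq_zero_iff by metis
  moreover have "val x = g" using x(2) by (simp add: K.hahn_val_monom)
  ultimately show "\<exists>x\<in>carrier Q. x \<noteq> \<zero> \<and> val x = g" using x(1) by blast
qed

lemma in_vball_iff_supp: "x \<in> vball g \<longleftrightarrow> x \<in> carrier Q \<and> K.supp (e x) \<subseteq> {g..}"
proof (cases "x \<in> carrier Q \<and> x \<noteq> \<zero>")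
  case True
  then show ?thesis
    using K.hahn_val_ge_iff[of "e x" g] e_closed[of x] e_eq_zero_iff by (auto simp: vball_def)
next
  case False
  moreover have "K.supp (e \<zero>) = {}" using e_eq_zero_iff[of \<zero>] by (simp add: K.supp_def K.hahn_zero)
  ultimately show ?thesis by (auto simp: vball_def)
qed

lemma zero_coefficient_eq_zero_iff:
  assumes x: "x \<in> vring"
  shows "e x 0 = \<zero>\<^bsub>K\<^esub> \<longleftrightarrow> x = \<zero> \<or> 0 < val x"
proof (cases "x = \<zero>")
  case True
  then show ?thesis using e_eq_zero_iff[of \<zero>] by (simp add: K.hahn_zero)
next
  case False
  have ex: "e x \<in> carrier K.hahn" "e x \<noteq> \<zero>\<^bsub>K.hahn\<^esub>"
    using False e_closed e_eq_zero_iff vball_carrier[OF x] by simp_all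
  have nonneg: "0 \<le> val x" using False x in_vball_iff[of x 0] vball_carrier[OF x] by simp
  have "0 \<in> K.supp (e x) \<longleftrightarrow> val x = 0"
  proof
    assume "0 \<in> K.supp (e x)"
    then have "val x \<le> 0" using K.supp_atLeast_hahn_val[OF ex] by auto
    then show "val x = 0" using nonneg by (rule antisym)
  next
    assume "val x = 0"
    then show "0 \<in> K.supp (e x)" using K.hahn_val_in_supp[OF ex] by simp
  qed
  then show ?thesis using False nonneg by (auto simp: K.in_supp_iff)
qed

lemma zero_coefficient_hom: "(\<lambda>x. e x 0) \<in> ring_hom (Q\<lparr>carrier := vring\<rparr>) K"
proof (rule ring_hom_memI)
  fix x y assume "x \<in> carrier (Q\<lparr>carrier := vring\<rparr>)" "y \<in> carrier (Q\<lparr>carrier := vring\<rparr>)"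
  then have xy: "x \<in> carrier Q" "K.supp (e x) \<subseteq> {0..}" "y \<in> carrier Q" "K.supp (e y) \<subseteq> {0..}"
    by (auto simp: in_vball_iff_supp)
  show "e x 0 \<in> carrier K" using e_closed[OF xy(1)] by simp
  show "e (x \<otimes>\<^bsub>Q\<lparr>carrier := vring\<rparr>\<^esub> y) 0 = e x 0 \<otimes>\<^bsub>K\<^esub> e y 0"
    using K.hahn_mult_lowest_coeff[OF e_closed[OF xy(1)] xy(2) e_closed[OF xy(3)] xy(4)] xy
    by (simp add: ring_hom_mult[OF e_hom])
  show "e (x \<oplus>\<^bsub>Q\<lparr>carrier := vring\<rparr>\<^esub> y) 0 = e x 0 \<oplus>\<^bsub>K\<^esub> e y 0"
    using xy by (simp add: ring_hom_add[OF e_hom] K.hahn_add)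
next
  show "e \<one>\<^bsub>Q\<lparr>carrier := vring\<rparr>\<^esub> 0 = \<one>\<^bsub>K\<^esub>" using ring_hom_one[OF e_hom] by (simp add: K.hahn_one)
qed

lemma residue_field_iso_coefficient_field: "residue_field Q vring \<simeq> K"
proof (rule residue_field_iso[OF K.ring_axioms zero_coefficient_hom _ zero_coefficient_eq_zero_iff])
  show "carrier K \<subseteq> (\<lambda>x. e x 0) ` vring"
  proof
    fix c assume "c \<in> carrier K"
    then obtain x where x: "x \<in> carrier Q" "e x = K.hahn_monom c 0"
      using monom_in_image[of c 0] by (metis imageE)
    then have "x \<in> vring"
      by (auto simp: in_vball_iff_supp K.supp_def K.hahn_monom_def split: if_splits)
    then show "c \<in> (\<lambda>x. e x 0) ` vring"
      using x(2) by (intro image_eqI[of _ _ x]) (auto simp: K.hahn_monom_def)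
  qed
qed

lemma essentially_uncountable_if_indicator_series:
  assumes aleph1: "aleph1_valued_field Q val u"
    and E: "wfp_on E (<)" "E \<subseteq> {0..<g}"
    and \<A>: "uncountable \<A>" "\<A> \<subseteq> Pow E" "K.indicator_series ` \<A> \<subseteq> e ` carrier Q"
  shows "essentially_uncountable_type Q vring (carrier Q)"
proof -
  interpret aleph1_valued_field Q val u by (rule aleph1)
  define x where "x A = inv_into (carrier Q) e (K.indicator_series A)" for A
  have x: "x A \<in> carrier Q" "e (x A) = K.indicator_series A" if "A \<in> \<A>" for A
  proof -
    have "K.indicator_series A \<in> e ` carrier Q" using that \<A>(3) by blast
    then show "x A \<in> carrier Q" "e (x A) = K.indicator_series A"
      unfolding x_def by (rule inv_into_into, rule f_inv_into_f)
  qed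
  have wf: "wfp_on A (<)" if "A \<in> \<A>" for A using that \<A>(2) by (intro wfp_on_subset[OF E(1)]) auto
  have "inj_on x \<A>"
  proof (rule inj_onI)
    fix A B assume "A \<in> \<A>" "B \<in> \<A>" "x A = x B"
    then have "K.indicator_series A = K.indicator_series B" using x(2) by metis
    then show "A = B" by (rule injD[OF K.inj_indicator_series])
  qed
  then have "uncountable (x ` \<A>)" using \<A>(1) countable_image_inj_on[of x \<A>] by auto
  moreover have "x ` \<A> \<subseteq> vring"
    using \<A>(2) E(2) by (force simp: in_vball_iff_supp x K.supp_indicator_series)
  moreover have "val (y \<ominus> z) < g" if yz: "y \<in> x ` \<A>" "z \<in> x ` \<A>" "y \<noteq> z" for y z
  proof -
    obtain A B where AB: "A \<in> \<A>" "y = x A" "B \<in> \<A>" "z = x B" using yz(1,2) by blast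
    then have "A \<noteq> B" using yz(3) by blast
    then have "K.hahn_val (e (x A) \<ominus>\<^bsub>K.hahn\<^esub> e (x B)) \<in> A \<union> B"
      unfolding x(2)[OF AB(1)] x(2)[OF AB(3)]
      by (rule K.hahn_val_indicator_series_minus[OF wf[OF AB(1)] wf[OF AB(3)]])
    then have "val (y \<ominus> z) \<in> E" using AB x(1) \<A>(2) by (auto simp: e_minus)
    then show ?thesis using E(2) by auto
  qed
  ultimately show ?thesis by (rule essentially_uncountable_type_vring)
qed

lemma strongly_countable_if_fractions:
  fixes D :: "'g \<Rightarrow> 'g set"
  assumes aleph1: "aleph1_valued_field Q val u" and K: "countable (carrier K)"
    and image: "e ` carrier Q \<subseteq> fractions K.hahn K.finite_series"
    and D: "\<And>g. convex_subgroup (D g)" "\<And>g. countable (D g)" "\<And>g. g \<in> D g"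
  shows "strongly_countable_type Q vring (carrier Q)"
proof -
  interpret aleph1_valued_field Q val u by (rule aleph1)
  show ?thesis
  proof (rule strongly_countable_type_vring[of "\<lambda>g x. K.truncate (D g) (e x)"])
    fix g
    have "e ` vring \<subseteq> {f \<in> fractions K.hahn K.finite_series. K.supp f \<subseteq> {0..}}"
      using image by (auto simp: in_vball_iff_supp)
    then have "(\<lambda>x. K.truncate (D g) (e x)) ` vring \<subseteq>
        K.truncate (D g) ` {f \<in> fractions K.hahn K.finite_series. K.supp f \<subseteq> {0..}}"
      by blast
    then show "countable ((\<lambda>x. K.truncate (D g) (e x)) ` vring)"
      by (rule countable_subset) (rule K.countable_truncate_fractions_finite_series[OF K D(1,2)])
    fix x y assume xy: "x \<in> vring" "y \<in> vring" "K.truncate (D g) (e x) = K.truncate (D g) (e y)"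
    then have "K.supp (e x \<ominus>\<^bsub>K.hahn\<^esub> e y) \<subseteq> {g..}"
      by (intro K.supp_minus_if_truncate_eq[OF D(1,3)]) (auto simp: in_vball_iff_supp e_closed)
    then show "x \<ominus> y \<in> vball g" using xy by (simp add: in_vball_iff_supp e_minus)
  qed
qed

end

section \<open>A value group of cofinality aleph one\<close>

typedef omega1 = omega1_idx
  using uncountable_omega1_idx by (metis countable_empty ex_in_conv)

text \<open>The order is reversed: in the lexicographic order on finitely supported functions the
  smallest index dominates, and here the largest ordinal has to.\<close>

instantiation omega1 :: linorder
begin

definition less_eq_omega1 :: "omega1 \<Rightarrow> omega1 \<Rightarrow> bool" where
  "a \<le> b \<longleftrightarrow> (Rep_omega1 b, Rep_omega1 a) \<in> aleph1"

definition less_omega1 :: "omega1 \<Rightarrow> omega1 \<Rightarrow> bool" where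
  "a < b \<longleftrightarrow> a \<le> b \<and> \<not> b \<le> (a::omega1)"

instance
proof
  have refl: "Refl aleph1" and trans: "trans aleph1" and antisym: "antisym aleph1"
    using linear_order_aleph1 by (auto simp: order_on_defs)
  fix a b c :: omega1
  show "(a < b) = (a \<le> b \<and> \<not> b \<le> a)" by (simp add: less_omega1_def)
  show refl_le: "a \<le> a" for a :: omega1
    using refl Rep_omega1[of a] by (auto simp: less_eq_omega1_def refl_on_def)
  show "a \<le> c" if "a \<le> b" "b \<le> c"
    using transD[OF trans] that unfolding less_eq_omega1_def by blast
  show "a = b" if "a \<le> b" "b \<le> a"
    using antisymD[OF antisym] that unfolding less_eq_omega1_def Rep_omega1_inject[symmetric] by blast
  show "a \<le> b \<or> b \<le> a"
    using aleph1_total[OF Rep_omega1[of a] Rep_omega1[of b]] refl_le[of a]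
    by (cases "a = b") (auto simp: less_eq_omega1_def Rep_omega1_inject)
qed

end

lemma Abs_omega1_less_iff:
  assumes "i \<in> omega1_idx" "j \<in> omega1_idx"
  shows "Abs_omega1 j < Abs_omega1 i \<longleftrightarrow> (i, j) \<in> aleph1 \<and> i \<noteq> j"
  using assms unfolding less_le less_eq_omega1_def
  by (auto simp: Abs_omega1_inverse Abs_omega1_inject)

lemma Rep_omega1_less_iff:
  "a < b \<longleftrightarrow> (Rep_omega1 b, Rep_omega1 a) \<in> aleph1 \<and> Rep_omega1 b \<noteq> Rep_omega1 a"
  using Abs_omega1_less_iff[OF Rep_omega1[of b] Rep_omega1[of a]] by (simp add: Rep_omega1_inverse)

lemma card_of_omega1: "|UNIV :: omega1 set| \<le>o aleph1"
proof -
  have "|UNIV :: omega1 set| \<le>o |omega1_idx|"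
    by (rule card_of_ordLeqI[of Rep_omega1]) (auto simp: inj_on_def Rep_omega1_inject Rep_omega1)
  then show ?thesis by (rule ordLeq_ordIso_trans[OF _ card_of_omega1_idx])
qed

lemma countable_omega1_greaterThan: "countable {a :: omega1. b < a}"
proof -
  have "countable (Rep_omega1 ` {a. b < a})"
    by (rule countable_subset[OF _ countable_underS_aleph1[OF Rep_omega1[of b]]])
      (auto simp: underS_def Rep_omega1_less_iff)
  then show ?thesis by (rule countable_image_inj_on) (simp add: inj_on_def Rep_omega1_inject)
qed

lemma countable_omega1_bounded:
  assumes "countable (A :: omega1 set)"
  obtains b where "\<And>a. a \<in> A \<Longrightarrow> b < a"
proof -
  have "countable (Rep_omega1 ` A)" "Rep_omega1 ` A \<subseteq> omega1_idx" using assms Rep_omega1 by auto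
  then obtain j where j: "j \<in> omega1_idx" "\<And>i. i \<in> Rep_omega1 ` A \<Longrightarrow> (i, j) \<in> aleph1 \<and> i \<noteq> j"
    using countable_omega1_idx_bounded by metis
  have "Abs_omega1 j < a" if "a \<in> A" for a
    using j(2)[of "Rep_omega1 a"] that by (simp add: Rep_omega1_less_iff Abs_omega1_inverse[OF j(1)])
  then show thesis by (rule that)
qed

type_synonym vgrp = "omega1 \<Rightarrow>\<^sub>0 int"

lemma less_vgrp_iff:
  "(g :: vgrp) < h \<longleftrightarrow> (\<exists>k. Poly_Mapping.lookup g k < Poly_Mapping.lookup h k \<and>
    (\<forall>k'<k. Poly_Mapping.lookup g k' = Poly_Mapping.lookup h k'))"
  by (simp add: less_poly_mapping.rep_eq less_fun_def)

lemma card_of_vgrp: "|UNIV :: vgrp set| \<le>o aleph1"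
  using card_of_poly_mapping_ordLeq[OF Cinfinite_aleph1 card_of_omega1
      countable_ordLeq_Cinfinite[OF countableI_type Cinfinite_aleph1]]
  by simp

definition level :: "omega1 \<Rightarrow> vgrp set" where
  "level \<sigma> = {h. \<forall>k\<le>\<sigma>. Poly_Mapping.lookup h k = 0}"

lemma zero_in_level: "0 \<in> level \<sigma>"
  by (simp add: level_def)

lemma level_less:
  assumes "g \<in> level \<sigma>" "h \<notin> level \<sigma>" "0 < h"
  shows "g < h"
proof -
  obtain k where k: "0 < Poly_Mapping.lookup h k" "\<forall>k'<k. Poly_Mapping.lookup h k' = 0"
    using assms(3) unfolding less_vgrp_iff by auto
  have "k \<le> \<sigma>" using assms(2) k(2) by (auto simp: level_def)
  then show ?thesis
    using assms(1) k unfolding less_vgrp_iff level_def by (intro exI[of _ k]) auto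
qed

lemma convex_subgroup_level: "convex_subgroup (level \<sigma>)"
  unfolding convex_subgroup_def
proof (intro conjI ballI allI impI)
  show "0 \<in> level \<sigma>" by (rule zero_in_level)
  show "g - h \<in> level \<sigma>" if "g \<in> level \<sigma>" "h \<in> level \<sigma>" for g h
    using that by (simp add: level_def lookup_minus)
  show "h \<in> level \<sigma>" if "g \<in> level \<sigma>" "0 \<le> h" "h \<le> g" for g h
    using level_less[of g \<sigma> h] that zero_in_level by (metis leD order_le_imp_less_or_eq)
qed

lemma countable_level: "countable (level \<sigma>)"
proof -
  have "countable {p :: vgrp. Poly_Mapping.keys p \<subseteq> {k. \<sigma> < k}}"
    using card_of_poly_mapping_ordLeq[OF natLeq_Cinfinite, of "{k. \<sigma> < k}"]
      countable_omega1_greaterThan countableI_type[of "UNIV :: int set"]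
    unfolding countable_card_le_natLeq by blast
  moreover have "level \<sigma> \<subseteq> {p. Poly_Mapping.keys p \<subseteq> {k. \<sigma> < k}}"
    by (auto simp: level_def in_keys_iff) (meson not_le)
  ultimately show ?thesis by (rule countable_subset[rotated])
qed

lemma ex_level: "\<exists>\<sigma>. g \<in> level \<sigma>"
proof -
  have "countable (Poly_Mapping.keys g)" by (simp add: countable_finite)
  then obtain \<sigma> where \<sigma>: "\<And>k. k \<in> Poly_Mapping.keys g \<Longrightarrow> \<sigma> < k" using countable_omega1_bounded by blast
  have "Poly_Mapping.lookup g k = 0" if "k \<le> \<sigma>" for k
    using \<sigma> that by (metis in_keys_iff leD)
  then show ?thesis by (auto simp: level_def)
qed

lemma single_in_level_iff: "n \<noteq> 0 \<Longrightarrow> Poly_Mapping.single \<tau> n \<in> level \<sigma> \<longleftrightarrow> \<sigma> < \<tau>"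
  by (auto simp: level_def lookup_single when_def not_le)

lemma single_pos_iff: "0 < (Poly_Mapping.single \<sigma> n :: vgrp) \<longleftrightarrow> 0 < n"
  unfolding less_vgrp_iff by (auto simp: lookup_single when_def)

definition unit_value :: "nat set \<Rightarrow> vgrp" where
  "unit_value i = Poly_Mapping.single (Abs_omega1 i) 1"

lemma unit_value_pos: "0 < unit_value i"
  by (simp add: unit_value_def single_pos_iff)

lemma unit_value_less:
  assumes "(i, j) \<in> aleph1" "i \<noteq> j"
  shows "unit_value i < unit_value j"
proof -
  have "Abs_omega1 j < Abs_omega1 i" using assms by (simp add: Abs_omega1_less_iff FieldI1 FieldI2)
  then have "unit_value i \<in> level (Abs_omega1 j)" "unit_value j \<notin> level (Abs_omega1 j)"
    by (simp_all add: unit_value_def single_in_level_iff)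
  then show ?thesis by (rule level_less[OF _ _ unit_value_pos])
qed

lemma level_less_unit_value: "g \<in> level \<sigma> \<Longrightarrow> g < unit_value (Rep_omega1 \<sigma>)"
  by (erule level_less[OF _ _ unit_value_pos])
    (simp add: unit_value_def Rep_omega1_inverse single_in_level_iff)

lemma unit_value_cofinal: "\<exists>i\<in>omega1_idx. g < unit_value i"
  using ex_level[of g] level_less_unit_value Rep_omega1 by blast

lemma ex_bounded_vgrp_sequence:
  obtains s :: "nat \<Rightarrow> vgrp" and g where "strict_mono s" "range s \<subseteq> {0..<g}"
proof -
  fix \<tau> :: omega1
  obtain \<sigma> where "Poly_Mapping.single \<tau> 1 \<in> level \<sigma>" using ex_level by blast
  then have \<sigma>: "\<sigma> < \<tau>" by (simp add: single_in_level_iff)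
  define s :: "nat \<Rightarrow> vgrp" where "s n = Poly_Mapping.single \<tau> (int n)" for n
  have diff: "s (Suc n) - s n = Poly_Mapping.single \<tau> 1" for n
    by (simp add: s_def single_diff[symmetric])
  have "s n < s (Suc n)" for n
    using single_pos_iff[of \<tau> 1] unfolding diff[of n, symmetric] by simp
  then have mono: "strict_mono s" by (simp add: strict_mono_Suc_iff)
  have "s n \<in> level \<sigma>" for n
    using \<sigma> zero_in_level by (cases "n = 0") (simp_all add: s_def single_in_level_iff)
  then have "s n < unit_value (Rep_omega1 \<sigma>)" for n by (rule level_less_unit_value)
  moreover have "0 \<le> s n" for n
    using strict_mono_less_eq[OF mono, of 0 n] by (simp add: s_def)
  ultimately show thesis by (intro that[OF mono, of "unit_value (Rep_omega1 \<sigma>)"]) auto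
qed

section \<open>The two valuation domains\<close>

context field
begin

lemma exists_hahn_embedded_field:
  fixes P :: "(vgrp \<Rightarrow> 'a) set"
  assumes P: "subfield P hahn" and card: "|P| \<le>o aleph1"
    and monom: "\<And>c g. c \<in> carrier R \<Longrightarrow> hahn_monom c g \<in> P"
  obtains Q :: "nat set ring" and e where "hahn_embedded_field R Q e" "e ` carrier Q = P"
    "aleph1_valued_field Q (hahn_val \<circ> e) unit_value"
proof -
  interpret H: field "hahn :: (vgrp \<Rightarrow> 'a) ring" by (rule hahn_field)
  have "|P| \<le>o |omega1_idx|"
    using card by (rule ordLeq_ordIso_trans[OF _ ordIso_symmetric[OF card_of_omega1_idx]])
  then obtain f :: "(vgrp \<Rightarrow> 'a) \<Rightarrow> nat set" where "inj_on f P"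
    unfolding card_of_ordLeq[symmetric] by blast
  then obtain Q :: "nat set ring" and e
    where Q: "field Q" "e \<in> ring_hom Q hahn" "bij_betw e (carrier Q) P"
    using H.subfield_copy[OF P] by blast
  have image: "e ` carrier Q = P" using Q(3) by (rule bij_betw_imp_surj_on)
  have sub: "hahn_embedded_field R Q e"
    by (intro hahn_embedded_field.intro hahn_embedded_field_axioms.intro field_axioms Q(1,2))
      (simp add: image monom)
  then interpret Q: hahn_embedded_field R Q e .
  have "|carrier Q| \<le>o aleph1"
    using card_of_ordIsoI[OF Q(3)] card by (rule ordIso_ordLeq_trans)
  then have "aleph1_valued_field Q (hahn_val \<circ> e) unit_value"
    by (intro aleph1_valued_field.intro aleph1_valued_field_axioms.intro Q.surj_valued_field_axioms
        unit_value_pos unit_value_less unit_value_cofinal)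
  then show thesis using that sub image by blast
qed

lemma card_of_monomials:
  assumes "countable (carrier R)"
  shows "|{hahn_monom c g | c (g :: vgrp). c \<in> carrier R}| \<le>o aleph1"
proof -
  have "{hahn_monom c g | c (g :: vgrp). c \<in> carrier R} \<subseteq> case_prod hahn_monom ` (carrier R \<times> UNIV)"
    by auto
  then show ?thesis
    by (rule card_of_subset_image_ordLeq)
      (intro card_of_Times_ordLeq countable_ordLeq_Cinfinite Cinfinite_aleph1 assms card_of_vgrp)
qed

lemma exists_essentially_uncountable_hahn_embedded_field:
  assumes R: "countable (carrier R)"
  obtains Q :: "nat set ring" and e :: "nat set \<Rightarrow> vgrp \<Rightarrow> 'a" where "hahn_embedded_field R Q e"
    "aleph1_valued_field Q (hahn_val \<circ> e) unit_value"
    "essentially_uncountable_type Q (valued_field.vball Q (hahn_val \<circ> e) 0) (carrier Q)"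
proof -
  interpret H: field "hahn :: (vgrp \<Rightarrow> 'a) ring" by (rule hahn_field)
  obtain s :: "nat \<Rightarrow> vgrp" and g where s: "strict_mono s" "range s \<subseteq> {0..<g}"
    by (rule ex_bounded_vgrp_sequence)
  define \<A> where "\<A> = (`) s ` omega1_idx"
  define G where "G = {hahn_monom c g | c (g :: vgrp). c \<in> carrier R} \<union> indicator_series ` \<A>"
  have E: "wfp_on (range s) (<)" by (rule wfp_on_less_range_strict_mono[OF s(1)])
  have \<A>: "\<A> \<subseteq> Pow (range s)" by (auto simp: \<A>_def)
  have "G \<subseteq> carrier hahn"
    using \<A> by (auto simp: G_def hahn_monom_closed intro!: indicator_series_closed wfp_on_subset[OF E])
  have "|omega1_idx| \<le>o aleph1" by (rule ordIso_imp_ordLeq[OF card_of_omega1_idx])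
  then have "|G| \<le>o aleph1"
    unfolding G_def \<A>_def
    by (intro Un_Cinfinite_bound card_of_monomials R card_of_image_ordLeq Cinfinite_aleph1)
  then have "|generate_field hahn G| \<le>o aleph1"
    by (rule card_of_generate_field_ordLeq[OF Cinfinite_aleph1])
  have incl: "G \<subseteq> generate_field hahn G" by (auto intro: generate_field.incl)
  have "subfield (generate_field hahn G) hahn"
    by (rule H.generate_field_is_subfield[OF \<open>G \<subseteq> carrier hahn\<close>])
  moreover note \<open>|generate_field hahn G| \<le>o aleph1\<close>
  moreover have "hahn_monom c g \<in> generate_field hahn G" if "c \<in> carrier R" for c g
    using that incl by (force simp: G_def)
  ultimately obtain Q :: "nat set ring" and e where Q: "hahn_embedded_field R Q e"
      "e ` carrier Q = generate_field hahn G" "aleph1_valued_field Q (hahn_val \<circ> e) unit_value"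
    by (rule exists_hahn_embedded_field)
  interpret Q: hahn_embedded_field R Q e by (rule Q(1))
  have "uncountable \<A>"
    unfolding \<A>_def by (intro uncountable_images_omega1_idx strict_mono_imp_inj_on s(1))
  then have "essentially_uncountable_type Q Q.vring (carrier Q)"
    using \<A> incl Q(2)
    by (intro Q.essentially_uncountable_if_indicator_series[OF Q(3) E s(2)]) (auto simp: G_def)
  then show thesis using that Q(1,3) by blast
qed

lemma exists_strongly_countable_hahn_embedded_field:
  assumes R: "countable (carrier R)"
  obtains Q :: "nat set ring" and e :: "nat set \<Rightarrow> vgrp \<Rightarrow> 'a" where "hahn_embedded_field R Q e"
    "aleph1_valued_field Q (hahn_val \<circ> e) unit_value"
    "strongly_countable_type Q (valued_field.vball Q (hahn_val \<circ> e) 0) (carrier Q)"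
proof -
  interpret H: field "hahn :: (vgrp \<Rightarrow> 'a) ring" by (rule hahn_field)
  let ?P = "fractions hahn (finite_series :: (vgrp \<Rightarrow> 'a) set)"
  have "subfield ?P hahn" by (rule H.subfield_fractions[OF finite_series_subring])
  moreover have "|?P| \<le>o aleph1"
    by (intro H.card_of_fractions_ordLeq card_of_finite_series_ordLeq Cinfinite_aleph1 card_of_vgrp
        countable_ordLeq_Cinfinite R)
  moreover have "hahn_monom c g \<in> ?P" if "c \<in> carrier R" for c g
    using hahn_monom_finite[OF that] H.subset_fractions[OF finite_series_subring] by blast
  ultimately obtain Q :: "nat set ring" and e where Q: "hahn_embedded_field R Q e" "e ` carrier Q = ?P"
      "aleph1_valued_field Q (hahn_val \<circ> e) unit_value"
    by (rule exists_hahn_embedded_field)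
  interpret Q: hahn_embedded_field R Q e by (rule Q(1))
  obtain \<sigma> :: "vgrp \<Rightarrow> omega1" where "\<And>g. g \<in> level (\<sigma> g)" using ex_level by metis
  then have "strongly_countable_type Q Q.vring (carrier Q)"
    using Q(2) by (intro Q.strongly_countable_if_fractions[OF Q(3) R, of "\<lambda>g. level (\<sigma> g)"])
      (auto simp: convex_subgroup_level countable_level)
  then show thesis using that Q(1,3) by blast
qed

end

theorem mainTheorem2:
  fixes K :: "('k, 'e) ring_scheme"
  assumes "field K" and "countable (carrier K)"
  shows "\<exists>(Q1 :: nat set ring) R1 (Q2 :: nat set ring) R2.
    valuation_domain_in Q1 R1 \<and> valuation_domain_in Q2 R2 \<and>
    card_eq_aleph1 R1 \<and> card_eq_aleph1 R2 \<and>
    residue_field Q1 R1 \<simeq> K \<and> residue_field Q2 R2 \<simeq> K \<and>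
    same_value_group Q1 R1 Q2 R2 \<and>
    (\<exists>S \<subseteq> carrier Q1. card_le_aleph1 S \<and> rspan Q1 R1 S = carrier Q1) \<and>
    (\<forall>S \<subseteq> carrier Q1. countable S \<longrightarrow> rspan Q1 R1 S \<noteq> carrier Q1) \<and>
    (\<exists>S \<subseteq> carrier Q2. card_le_aleph1 S \<and> rspan Q2 R2 S = carrier Q2) \<and>
    (\<forall>S \<subseteq> carrier Q2. countable S \<longrightarrow> rspan Q2 R2 S \<noteq> carrier Q2) \<and>
    essentially_uncountable_type Q1 R1 (carrier Q1) \<and>
    strongly_countable_type Q2 R2 (carrier Q2)"
proof -
  interpret K: field K by fact
  obtain Q1 :: "nat set ring" and e1 where Q1: "hahn_embedded_field K Q1 e1"
      "aleph1_valued_field Q1 (K.hahn_val \<circ> e1) unit_value"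
    and type1: "essentially_uncountable_type Q1
      (valued_field.vball Q1 (K.hahn_val \<circ> e1) 0) (carrier Q1)"
    using K.exists_essentially_uncountable_hahn_embedded_field[OF assms(2)] by blast
  obtain Q2 :: "nat set ring" and e2 where Q2: "hahn_embedded_field K Q2 e2"
      "aleph1_valued_field Q2 (K.hahn_val \<circ> e2) unit_value"
    and type2: "strongly_countable_type Q2
      (valued_field.vball Q2 (K.hahn_val \<circ> e2) 0) (carrier Q2)"
    using K.exists_strongly_countable_hahn_embedded_field[OF assms(2)] by blast
  interpret Q1: hahn_embedded_field K Q1 e1 by (rule Q1)
  interpret Q2: hahn_embedded_field K Q2 e2 by (rule Q2)
  interpret V1: aleph1_valued_field Q1 Q1.val unit_value by (rule Q1)
  interpret V2: aleph1_valued_field Q2 Q2.val unit_value by (rule Q2)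
  have "same_value_group Q1 Q1.vring Q2 Q2.vring"
    by (rule same_value_group_vring[OF Q1.surj_valued_field_axioms Q2.surj_valued_field_axioms])
  then show ?thesis
    using V1.valuation_domain_in_vring V1.card_eq_aleph1_vring
      V1.ex_generators_card_le_aleph1 V1.not_countably_generated
      V2.valuation_domain_in_vring V2.card_eq_aleph1_vring
      V2.ex_generators_card_le_aleph1 V2.not_countably_generated
      Q1.residue_field_iso_coefficient_field Q2.residue_field_iso_coefficient_field type1 type2
    by (intro exI[of _ Q1] exI[of _ Q1.vring] exI[of _ Q2] exI[of _ Q2.vring]) simp
qed

end
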